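(* Let $\varphi$ be a holomorphic quadratic form on $\mathbf{C}^n_x\times\mathbf{C}^n_y$ with $\det\varphi''_{xy}\neq 0$ and $\operatorname{Im}\varphi''_{yy}>0$, let $\Phi(x)=\sup_{y\in\mathbf{R}^n}(-\operatorname{Im}\varphi(x,y))$ for $x\in\mathbf{C}^n$, and let $\psi(x,y)$ be the unique holomorphic quadratic form on $\mathbf{C}^n_x\times\mathbf{C}^n_y$ such that $\psi(x,\bar x)=\Phi(x)$ for all $x\in\mathbf{C}^n$. Then the orthogonal projection $\Pi:L^2_\Phi(\mathbf{C}^n)\to H_\Phi(\mathbf{C}^n)$ is given by $$\Pi u(x)=\frac{2^n\det\psi''_{xy}}{(\pi h)^n}\int_{\mathbf{C}^n}e^{2\psi(x,\bar y)/h}u(y)e^{-2\Phi(y)/h}\,L(dy).$$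
   Context: Here $0<h\le1$; $L(dy)$ is the Lebesgue measure on $\mathbf{C}^n$; $L^2_\Phi(\mathbf{C}^n)=L^2(\mathbf{C}^n,e^{-2\Phi/h}L(dx))$; $H_\Phi(\mathbf{C}^n)\subset L^2_\Phi(\mathbf{C}^n)$ is the closed subspace of holomorphic functions. $\Phi$ is a real quadratic form on $\mathbf{C}^n\simeq\mathbf{R}^{2n}$ and is strictly pluri-subharmonic. $\varphi''_{xy}$, $\varphi''_{yy}$, $\psi''_{xy}$ are the constant matrices of second derivatives, and $\operatorname{Im}\varphi''_{yy}>0$ means the imaginary part is positive definite. *)

theory Defs
  imports "HOL-Analysis.Analysis"
begin

definition vec_cnj :: "complex ^ 'n \<Rightarrow> complex ^ 'n" where
  "vec_cnj x = (\<chi> i. cnj (x $ i))"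

definition vec_of_real :: "real ^ 'n \<Rightarrow> complex ^ 'n" where
  "vec_of_real y = (\<chi> i. complex_of_real (y $ i))"

text \<open>Holomorphic quadratic forms on \<open>C\<^sup>n \<times> C\<^sup>n\<close>: homogeneous polynomials of degree 2
  in the \<open>2n\<close> complex variables, without any symmetry normalisation of the coefficients.\<close>

definition holomorphic_quadratic_form ::
    "(complex ^ 'n \<Rightarrow> complex ^ 'n \<Rightarrow> complex) \<Rightarrow> bool" where
  "holomorphic_quadratic_form q \<longleftrightarrow>
     (\<exists>A B C :: complex ^ 'n ^ 'n. \<forall>x y. q x y =
        (\<Sum>j\<in>UNIV. \<Sum>k\<in>UNIV. A $ j $ k * x $ j * x $ k)
      + (\<Sum>j\<in>UNIV. \<Sum>k\<in>UNIV. B $ j $ k * x $ j * y $ k)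
      + (\<Sum>j\<in>UNIV. \<Sum>k\<in>UNIV. C $ j $ k * y $ j * y $ k))"

text \<open>Matrices of second complex derivatives, taken at the origin; for a quadratic form
  they do not depend on the base point.\<close>

definition hessian_xy ::
    "(complex ^ 'n \<Rightarrow> complex ^ 'n \<Rightarrow> complex) \<Rightarrow> complex ^ 'n ^ 'n" where
  "hessian_xy q = (\<chi> j k. deriv (\<lambda>s. deriv (\<lambda>t. q (axis j s) (axis k t)) 0) 0)"

definition hessian_yy ::
    "(complex ^ 'n \<Rightarrow> complex ^ 'n \<Rightarrow> complex) \<Rightarrow> complex ^ 'n ^ 'n" where
  "hessian_yy q = (\<chi> j k. deriv (\<lambda>s. deriv (\<lambda>t. q 0 (axis j s + axis k t)) 0) 0)"

definition Im_matrix :: "complex ^ 'n ^ 'm \<Rightarrow> real ^ 'n ^ 'm" where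
  "Im_matrix A = (\<chi> j k. Im (A $ j $ k))"

definition positive_definite :: "real ^ 'n ^ 'n \<Rightarrow> bool" where
  "positive_definite A \<longleftrightarrow> (\<forall>v. v \<noteq> 0 \<longrightarrow> v \<bullet> (A *v v) > 0)"

text \<open>Square-integrable functions are represented by functions rather than by classes modulo
  equality almost everywhere.\<close>

definition L2_space :: "'a measure \<Rightarrow> ('a \<Rightarrow> complex) set" where
  "L2_space M = {u \<in> borel_measurable M. integrable M (\<lambda>x. (cmod (u x))\<^sup>2)}"

definition L2_inner :: "'a measure \<Rightarrow> ('a \<Rightarrow> complex) \<Rightarrow> ('a \<Rightarrow> complex) \<Rightarrow> complex" where
  "L2_inner M u v = (LINT x|M. u x * cnj (v x))"

definition weighted_lebesgue ::
    "(complex ^ 'n \<Rightarrow> real) \<Rightarrow> real \<Rightarrow> (complex ^ 'n) measure" where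
  "weighted_lebesgue \<Phi> h = density lebesgue (\<lambda>x. ennreal (exp (- 2 * \<Phi> x / h)))"

text \<open>Holomorphy on \<open>C\<^sup>n\<close>: the real derivative exists at every point and is complex linear.\<close>

definition holomorphic_Cn :: "(complex ^ 'n \<Rightarrow> complex) \<Rightarrow> bool" where
  "holomorphic_Cn u \<longleftrightarrow>
     (\<forall>x. \<exists>a :: complex ^ 'n. (u has_derivative (\<lambda>v. \<Sum>j\<in>UNIV. a $ j * v $ j)) (at x))"

definition holomorphic_L2 ::
    "(complex ^ 'n \<Rightarrow> real) \<Rightarrow> real \<Rightarrow> (complex ^ 'n \<Rightarrow> complex) set" where
  "holomorphic_L2 \<Phi> h = {u \<in> L2_space (weighted_lebesgue \<Phi> h). holomorphic_Cn u}"

text \<open>Orthogonality to \<open>H\<close> determines \<open>P u\<close> up to a null set; if, as for holomorphic functions,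
  members of \<open>H\<close> that agree almost everywhere are equal, it determines \<open>P u\<close> pointwise.\<close>

definition orthogonal_projection ::
    "'a measure \<Rightarrow> ('a \<Rightarrow> complex) set \<Rightarrow> (('a \<Rightarrow> complex) \<Rightarrow> ('a \<Rightarrow> complex)) \<Rightarrow> bool" where
  "orthogonal_projection M H P \<longleftrightarrow>
     (\<forall>u \<in> L2_space M. P u \<in> H \<and> (\<forall>v \<in> H. L2_inner M (\<lambda>x. u x - P u x) v = 0))"

end

theory Submission
  imports Defs "HOL-Probability.Distributions" "HOL-Complex_Analysis.Cauchy_Integral_Formula"
begin

text \<open>Polarisation turns the statement into one about a Gaussian weight. The identity
  \<open>\<psi>(x, cnj x) = \<Phi>(x)\<close> with \<open>\<Phi>\<close> real forces
  \<open>\<psi>(x, cnj y) = \<alpha>(x) + b(x, y) + cnj (\<alpha>(y))\<close> with \<open>\<alpha>\<close> a holomorphic quadratic form and \<open>b\<close> a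
  Hermitian form whose matrix is \<open>\<psi>''\<^sub>x\<^sub>y\<close>, so that \<open>\<Phi>(y) = 2 Re \<alpha>(y) + b(y, y)\<close>
  (\<open>polarized_weight\<close>). Since \<open>\<alpha>(\<i>w) = - \<alpha>(w)\<close>, one has \<open>2 b(w, w) = \<Phi>(w) + \<Phi>(\<i>w)\<close>; bounding both
  suprema from below by suitable test points shows that \<open>b\<close> is positive definite
  (\<open>sup_transform_levi_positive\<close>).

  With \<open>K\<close> the matrix of \<open>2 b / h\<close>, multiplication by the zero-free holomorphic function
  \<open>exp (- 2 \<alpha> / h)\<close> is a unitary map from the weighted space onto
  \<open>L\<^sup>2(exp (- K(y, y)) L(dy))\<close> that preserves holomorphy, and it carries the asserted integral
  operator to the operator with kernel \<open>\<pi>\<^sup>-\<^sup>n det K exp (K(x, y))\<close>. That operator is the projection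
  onto the holomorphic functions because it

  \<^item> maps into holomorphic functions, by differentiation under the integral
    (\<open>bergman_operator_holomorphic\<close>), and into \<open>L\<^sup>2\<close>, by Schur's test: after the weights are
    absorbed its kernel has the modulus of the convolution kernel \<open>exp (- K(x - y, x - y) / 2)\<close>
    (\<open>bergman_operator_L2\<close>);

  \<^item> is self-adjoint (\<open>bergman_operator_self_adjoint\<close>);

  \<^item> reproduces holomorphic functions (\<open>reproducing_property\<close>): after the translation \<open>y = x + w\<close> the
    integrand is an entire function \<open>g(w)\<close> with \<open>g(0) = v(x)\<close> times \<open>exp (- K(w, w))\<close>, and both this
    weight and Lebesgue measure are invariant under \<open>w \<mapsto> exp (\<i>\<theta>) w\<close>, so averaging over \<open>\<theta>\<close> leaves
    \<open>v(x)\<close> times the Gaussian integral \<open>\<pi>\<^sup>n / det K\<close>.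

  A projection is determined pointwise: testing orthogonality against \<open>exp (K(y, x))\<close>, which is itself
  holomorphic and square-integrable, recovers the value at \<open>x\<close> (\<open>bergman_operator_unique\<close>).

  The two facts about Lebesgue measure used here, invariance under rotations and the value
  of the Gaussian integral, are both reduced to shears along one real coordinate, for which
  invariance is Fubini's theorem and translation invariance on the line.\<close>

section \<open>Volume-preserving maps\<close>

definition preserves_volume :: "('a::euclidean_space \<Rightarrow> 'a) \<Rightarrow> bool" where
  "preserves_volume T \<longleftrightarrow> T \<in> borel_measurable borel \<and> distr lborel borel T = lborel"

lemma preserves_volume_compose:
  assumes "preserves_volume S" "preserves_volume T"
  shows "preserves_volume (\<lambda>x. S (T x))"
proof -
  have [measurable]: "S \<in> borel_measurable borel" "T \<in> borel_measurable borel"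
    using assms by (auto simp: preserves_volume_def)
  have "distr lborel borel (\<lambda>x. S (T x)) = distr (distr lborel borel T) borel S"
    by (subst distr_distr) (auto simp: comp_def)
  then show ?thesis
    using assms by (auto simp: preserves_volume_def)
qed

lemma nn_integral_preserves_volume:
  assumes "preserves_volume T" "f \<in> borel_measurable borel"
  shows "(\<integral>\<^sup>+x. f (T x) \<partial>lborel) = (\<integral>\<^sup>+x. f x \<partial>lborel)"
  using nn_integral_distr[of T lborel borel f] assms by (simp add: preserves_volume_def)

lemma integral_preserves_volume:
  fixes f :: "'a::euclidean_space \<Rightarrow> complex"
  assumes "preserves_volume T" "f \<in> borel_measurable borel"
  shows "(\<integral>x. f (T x) \<partial>lborel) = (\<integral>x. f x \<partial>lborel)"
  using integral_distr[of T lborel borel f] assms by (simp add: preserves_volume_def)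

text \<open>Splitting off one coordinate lets a shear be treated, with the other coordinates fixed, as a translation of the line.\<close>

lemma nn_integral_lborel_split:
  fixes f :: "'a::euclidean_space \<Rightarrow> ennreal"
  assumes b: "b \<in> Basis" and [measurable]: "f \<in> borel_measurable borel"
  shows "(\<integral>\<^sup>+x. f x \<partial>lborel) =
    (\<integral>\<^sup>+g. (\<integral>\<^sup>+y. f ((\<Sum>i\<in>Basis - {b}. g i *\<^sub>R i) + y *\<^sub>R b) \<partial>lborel) \<partial>(\<Pi>\<^sub>M i\<in>Basis - {b}. lborel))"
proof -
  interpret product_sigma_finite "\<lambda>_::'a. lborel :: real measure"
    by unfold_locales
  have B: "insert b (Basis - {b}) = (Basis :: 'a set)" using b by auto
  have upd: "(\<Sum>i\<in>Basis. (g(b := y)) i *\<^sub>R i) = (\<Sum>i\<in>Basis - {b}. g i *\<^sub>R i) + y *\<^sub>R b" for g y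
    by (subst sum.remove[OF finite_Basis b]) (simp add: add.commute)
  have "(\<integral>\<^sup>+x. f x \<partial>lborel) = (\<integral>\<^sup>+g. f (\<Sum>i\<in>Basis. g i *\<^sub>R i) \<partial>(\<Pi>\<^sub>M i\<in>Basis. lborel))"
    by (subst lborel_eq) (simp add: nn_integral_distr)
  also have "\<dots> = (\<integral>\<^sup>+g. f (\<Sum>i\<in>Basis. g i *\<^sub>R i) \<partial>(\<Pi>\<^sub>M i\<in>insert b (Basis - {b}). lborel))"
    by (simp only: B)
  also have "\<dots> = (\<integral>\<^sup>+g. (\<integral>\<^sup>+y. f (\<Sum>i\<in>Basis. (g(b := y)) i *\<^sub>R i) \<partial>lborel) \<partial>(\<Pi>\<^sub>M i\<in>Basis - {b}. lborel))"
  proof (rule product_nn_integral_insert)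
    show "(\<lambda>g. f (\<Sum>i\<in>Basis. g i *\<^sub>R i)) \<in> borel_measurable (Pi\<^sub>M (insert b (Basis - {b})) (\<lambda>i. lborel))"
      unfolding B by measurable
  qed auto
  finally show ?thesis
    by (simp only: upd)
qed

lemma preserves_volume_real_shear:
  fixes b :: "'a::euclidean_space"
  assumes b: "b \<in> Basis" and [measurable]: "l \<in> borel_measurable borel"
    and l: "\<And>x t. l (x + t *\<^sub>R b) = l x"
  shows "preserves_volume (\<lambda>x. x + l x *\<^sub>R b)"
  unfolding preserves_volume_def
proof
  show [measurable]: "(\<lambda>x. x + l x *\<^sub>R b) \<in> borel_measurable borel"
    by measurable
  show "distr lborel borel (\<lambda>x. x + l x *\<^sub>R b) = lborel"
  proof (rule measure_eqI)
    fix A assume "A \<in> sets (distr lborel borel (\<lambda>x. x + l x *\<^sub>R b))"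
    then have [measurable]: "A \<in> sets borel" by simp
    have *: "(\<integral>\<^sup>+y. f (s + y *\<^sub>R b + l (s + y *\<^sub>R b) *\<^sub>R b) \<partial>lborel) = (\<integral>\<^sup>+y. f (s + y *\<^sub>R b) \<partial>lborel)"
      if [measurable]: "f \<in> borel_measurable borel" for f :: "'a \<Rightarrow> ennreal" and s :: 'a
      using nn_integral_real_affine[of "\<lambda>y. f (s + y *\<^sub>R b)" 1 "l s"]
      by (simp add: l algebra_simps)
    have "emeasure (distr lborel borel (\<lambda>x. x + l x *\<^sub>R b)) A
        = (\<integral>\<^sup>+x. indicator A x \<partial>distr lborel borel (\<lambda>x. x + l x *\<^sub>R b))"
      by simp
    also have "\<dots> = (\<integral>\<^sup>+x. indicator A (x + l x *\<^sub>R b) \<partial>lborel)"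
      by (subst nn_integral_distr) auto
    also have "\<dots> = (\<integral>\<^sup>+x. indicator A x \<partial>lborel)"
      by (subst (1 2) nn_integral_lborel_split[OF b]) (simp_all add: *)
    finally show "emeasure (distr lborel borel (\<lambda>x. x + l x *\<^sub>R b)) A = emeasure lborel A"
      by simp
  qed simp
qed

lemma axis_Re_Im: "axis j c = Re c *\<^sub>R axis j 1 + Im c *\<^sub>R axis j \<i>"
  by (auto simp: vec_eq_iff axis_def complex_eq_iff)

lemma axis_in_Basis_complex: "axis j 1 \<in> (Basis :: (complex^'n) set)" "axis j \<i> \<in> (Basis :: (complex^'n) set)"
  by (auto simp: Basis_vec_def Basis_complex_def)

lemma preserves_volume_complex_shear:
  fixes l :: "complex^'n \<Rightarrow> complex"
  assumes [measurable]: "l \<in> borel_measurable borel"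
    and l: "\<And>x c. l (x + axis j c) = l x"
  shows "preserves_volume (\<lambda>x. x + axis j (l x))"
proof -
  have r1: "t *\<^sub>R axis j (1::complex) = axis j (of_real t)" "t *\<^sub>R axis j \<i> = axis j (of_real t * \<i>)" for t
    by (auto simp: vec_eq_iff axis_def scaleR_conv_of_real[where 'a=complex])
  have "preserves_volume (\<lambda>x. x + Re (l x) *\<^sub>R axis j 1)"
    by (rule preserves_volume_real_shear[OF axis_in_Basis_complex(1)]) (auto simp: r1 l)
  moreover have "preserves_volume (\<lambda>x. x + Im (l x) *\<^sub>R axis j \<i>)"
    by (rule preserves_volume_real_shear[OF axis_in_Basis_complex(2)]) (auto simp: r1 l)
  ultimately have "preserves_volume (\<lambda>x. (x + Re (l x) *\<^sub>R axis j 1) + Im (l (x + Re (l x) *\<^sub>R axis j 1)) *\<^sub>R axis j \<i>)"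
    by (rule preserves_volume_compose[rotated])
  then show ?thesis
    by (simp add: axis_Re_Im[of j "l _"] r1 l add.assoc)
qed

text \<open>A plane rotation through the angle \<open>\<theta>\<close> is a product of three shears, with parameters
  \<open>- tan (\<theta>/2)\<close>, \<open>sin \<theta>\<close>, \<open>- tan (\<theta>/2)\<close>; for \<open>\<theta> = \<pi>\<close>, where the tangent is infinite, the quarter turn is
  applied twice.\<close>

lemma preserves_volume_rotate_coordinate:
  fixes z :: complex
  assumes z: "cmod z = 1"
  shows "preserves_volume (\<lambda>x :: complex^'n. x + axis j ((z - 1) * x $ j))"
proof -
  have main: "preserves_volume (\<lambda>x :: complex^'n. x + axis j ((z - 1) * x $ j))"
    if "cmod z = 1" and "z \<noteq> -1" for z
  proof -
    \<comment> \<open>\<open>t = tan (\<theta>/2)\<close> and \<open>s = sin \<theta>\<close> for \<open>z = exp (\<i>\<theta>)\<close>.\<close>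
    define t s where "t = Im z / (1 + Re z)" and "s = Im z"
    have sq: "(Re z)\<^sup>2 + (Im z)\<^sup>2 = 1"
      using that cmod_power2[of z] by simp
    have nz: "1 + Re z \<noteq> 0"
    proof
      assume "1 + Re z = 0"
      then have "Re z = -1" by simp
      with sq have "Im z = 0" by simp
      with \<open>Re z = -1\<close> \<open>z \<noteq> -1\<close> show False by (simp add: complex_eq_iff)
    qed
    have ts: "t * s = 1 - Re z"
      using nz sq unfolding t_def s_def by (simp add: field_simps power2_eq_square)
    have t2: "t * (1 + Re z) = s"
      using nz by (simp add: t_def s_def)
    define P where "P = (\<lambda>x :: complex^'n. x + (- t * Im (x $ j)) *\<^sub>R axis j 1)"
    define R where "R = (\<lambda>x :: complex^'n. x + (s * Re (x $ j)) *\<^sub>R axis j \<i>)"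
    have "preserves_volume P"
      unfolding P_def 
      by (rule preserves_volume_real_shear[OF axis_in_Basis_complex(1)])
         (auto simp: axis_def intro!: borel_measurable_continuous_onI continuous_intros)
    moreover have "preserves_volume R"
      unfolding R_def 
      by (rule preserves_volume_real_shear[OF axis_in_Basis_complex(2)])
         (auto simp: axis_def intro!: borel_measurable_continuous_onI continuous_intros)
    ultimately have "preserves_volume (\<lambda>x. P (R (P x)))"
      using preserves_volume_compose by blast
    moreover have "P (R (P x)) = x + axis j ((z - 1) * x $ j)" for x
    proof -
      define p q where "p = Re (x $ j)" and "q = Im (x $ j)"
      have e1: "p - t * q - t * (q + s * (p - t * q)) = Re z * p - Im z * q"
      proof -
        have "p - t * q - t * (q + s * (p - t * q)) = p - (t * s) * p - (2 - t * s) * t * q"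
          by (simp add: algebra_simps)
        also have "\<dots> = Re z * p - (t * (1 + Re z)) * q"
          by (simp only: ts) (simp add: algebra_simps)
        finally show ?thesis by (simp add: t2 s_def)
      qed
      have e2: "q + s * (p - t * q) = Re z * q + Im z * p"
      proof -
        have "q + s * (p - t * q) = q - (t * s) * q + s * p" by (simp add: algebra_simps)
        also have "\<dots> = Re z * q + s * p" by (simp only: ts) (simp add: algebra_simps)
        finally show ?thesis by (simp add: s_def)
      qed
      have "P (R (P x)) = x + axis j (Complex (p - t * q - t * (q + s * (p - t * q)) - p) (q + s * (p - t * q) - q))"
        unfolding P_def R_def
        by (auto simp: vec_eq_iff axis_def complex_eq_iff p_def q_def algebra_simps)
      also have "Complex (p - t * q - t * (q + s * (p - t * q)) - p) (q + s * (p - t * q) - q) = (z - 1) * x $ j"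
        by (subst e1, subst e2) (simp add: complex_eq_iff p_def q_def algebra_simps)
      finally show ?thesis .
    qed
    ultimately show ?thesis by simp
  qed
  show ?thesis
  proof (cases "z = -1")
    case True
    have "preserves_volume (\<lambda>x :: complex^'n. x + axis j ((\<i> - 1) * x $ j))"
      by (rule main) (auto simp: complex_eq_iff)
    from preserves_volume_compose[OF this this] show ?thesis
      by (rule back_subst[of preserves_volume]) (auto simp: True fun_eq_iff vec_eq_iff axis_def algebra_simps)
  qed (use main z in blast)
qed

lemma preserves_volume_rotate:
  fixes z :: complex
  assumes z: "cmod z = 1"
  shows "preserves_volume (\<lambda>x :: complex^'n. z *s x)"
proof -
  have "preserves_volume (\<lambda>x :: complex^'n. \<chi> k. if k \<in> S then z * x $ k else x $ k)" if "finite S" for S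
    using that
  proof induction
    case empty
    then show ?case by (simp add: preserves_volume_def distr_id2)
  next
    case (insert j S)
    from preserves_volume_compose[OF preserves_volume_rotate_coordinate[OF z, of j] insert.IH] insert.hyps
    show ?case
      by (elim back_subst[of preserves_volume]) (auto simp: fun_eq_iff vec_eq_iff axis_def algebra_simps)
  qed
  from this[of UNIV] show ?thesis
    by (simp add: vector_scalar_mult_def)
qed

lemma preserves_volume_translate: "preserves_volume (\<lambda>x. a + x)" for a :: "'a::euclidean_space"
  using lborel_affine[of 1 a] by (simp add: preserves_volume_def density_1)

lemma preserves_volume_uminus: "preserves_volume (\<lambda>x. a - x)" for a :: "'a::euclidean_space"
  using lborel_affine[of "-1" a] by (simp add: preserves_volume_def density_1)

section \<open>Hermitian forms and Gaussian integrals\<close>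

definition sesq :: "complex^'n^'n \<Rightarrow> complex^'n \<Rightarrow> complex^'n \<Rightarrow> complex" where
  "sesq B x y = (\<Sum>j\<in>UNIV. \<Sum>k\<in>UNIV. B $ j $ k * x $ j * cnj (y $ k))"

text \<open>Positivity is stated for the real part; by the symmetry clause \<open>sesq B w w\<close> is real.\<close>

definition hermitian_positive :: "complex^'n^'n \<Rightarrow> bool" where
  "hermitian_positive B \<longleftrightarrow> (\<forall>j k. B $ k $ j = cnj (B $ j $ k)) \<and> (\<forall>w. w \<noteq> 0 \<longrightarrow> Re (sesq B w w) > 0)"

lemma hermitian_positiveD:
  assumes "hermitian_positive B"
  shows "B $ k $ j = cnj (B $ j $ k)" "w \<noteq> 0 \<Longrightarrow> Re (sesq B w w) > 0"
  using assms unfolding hermitian_positive_def by blast+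

lemma continuous_on_sesq [continuous_intros]:
  "continuous_on A f \<Longrightarrow> continuous_on A g \<Longrightarrow> continuous_on A (\<lambda>x. sesq B (f x) (g x))"
  unfolding sesq_def by (intro continuous_intros)

lemma measurable_sesq [measurable]:
  fixes f g :: "'a \<Rightarrow> complex^'n"
  assumes "f \<in> borel_measurable M" "g \<in> borel_measurable M"
  shows "(\<lambda>x. sesq B (f x) (g x)) \<in> borel_measurable M"
  by (rule borel_measurable_continuous_Pair[OF assms]) (intro continuous_intros)

lemma sesq_add: "sesq B (x + x') y = sesq B x y + sesq B x' y" "sesq B x (y + y') = sesq B x y + sesq B x y'"
  by (simp_all add: sesq_def algebra_simps sum.distrib)

lemma sesq_scale: "sesq B (c *s x) y = c * sesq B x y" "sesq B x (c *s y) = cnj c * sesq B x y"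
  by (simp_all add: sesq_def sum_distrib_left mult_ac)

lemma sesq_diff: "sesq B (x - x') y = sesq B x y - sesq B x' y" "sesq B x (y - y') = sesq B x y - sesq B x y'"
  by (simp_all add: sesq_def algebra_simps sum_subtractf)

lemma sesq_zero [simp]: "sesq B 0 y = 0" "sesq B x 0 = 0"
  by (simp_all add: sesq_def)

lemma axis_zero [simp]: "axis i 0 = 0"
  by (simp add: axis_def vec_eq_iff)

lemma sesq_axis:
  "sesq B (axis i s) y = s * (\<Sum>k\<in>UNIV. B $ i $ k * cnj (y $ k))"
  "sesq B x (axis i t) = cnj t * (\<Sum>j\<in>UNIV. B $ j $ i * x $ j)"
proof -
  have "(\<Sum>k\<in>UNIV. B $ j $ k * axis i s $ j * cnj (y $ k)) =
      (if j = i then s * (\<Sum>k\<in>UNIV. B $ i $ k * cnj (y $ k)) else 0)" for j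
    by (auto simp: axis_def sum_distrib_left mult_ac)
  then show "sesq B (axis i s) y = s * (\<Sum>k\<in>UNIV. B $ i $ k * cnj (y $ k))"
    unfolding sesq_def by simp
  have "B $ j $ k * x $ j * cnj (axis i t $ k) = (if k = i then B $ j $ i * x $ j * cnj t else 0)" for j k
    by (auto simp: axis_def)
  then show "sesq B x (axis i t) = cnj t * (\<Sum>j\<in>UNIV. B $ j $ i * x $ j)"
    unfolding sesq_def by (simp add: sum_distrib_left mult_ac)
qed

lemma sesq_axis_axis: "sesq B (axis i s) (axis j t) = s * cnj t * B $ i $ j"
proof -
  have "B $ i $ k * cnj (axis j t $ k) = (if k = j then B $ i $ j * cnj t else 0)" for k
    by (auto simp: axis_def)
  then show ?thesis by (simp add: sesq_axis(1))
qed

lemma sesq_cnj: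
  assumes "hermitian_positive B"
  shows "sesq B y x = cnj (sesq B x y)"
proof -
  have "cnj (B $ j $ k) = B $ k $ j" for j k
    by (rule hermitian_positiveD(1)[OF assms, symmetric])
  then have "cnj (sesq B x y) = (\<Sum>j\<in>UNIV. \<Sum>k\<in>UNIV. B $ k $ j * y $ k * cnj (x $ j))"
    by (simp add: sesq_def mult_ac)
  also have "\<dots> = sesq B y x"
    unfolding sesq_def by (rule sum.swap)
  finally show ?thesis by simp
qed

text \<open>The matrix differs from the identity by adding a combination of the other rows to row \<open>i\<close>.\<close>

lemma det_shear:
  fixes v :: "complex^'n"
  assumes "v $ i = 0"
  shows "det (\<chi> p q. (if p = q then 1 else 0) + (if p = i then v $ q else 0)) = 1"
proof -
  let ?A = "mat 1 :: complex^'n^'n"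
  have "(\<Sum>q\<in>UNIV - {i}. v $ q *s row q ?A) \<in> vec.span {row j ?A | j. j \<noteq> i}"
    by (intro vec.span_sum vec.span_scale vec.span_base) auto
  also have "(\<Sum>q\<in>UNIV - {i}. v $ q *s row q ?A) = v"
  proof -
    have "(\<Sum>q\<in>UNIV - {i}. v $ q *s row q ?A) $ k = (\<Sum>q\<in>UNIV - {i}. if q = k then v $ k else 0)" for k
      unfolding sum_component by (intro sum.cong refl) (auto simp: row_def mat_def)
    then show ?thesis using assms by (auto simp: vec_eq_iff)
  qed
  finally have "det (\<chi> k. if k = i then row i ?A + v else row k ?A) = det ?A"
    by (rule det_row_span)
  also have "(\<chi> k. if k = i then row i ?A + v else row k ?A) =
      (\<chi> p q. (if p = q then 1 else 0) + (if p = i then v $ q else 0))"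
    by (auto simp: vec_eq_iff row_def mat_def)
  finally show ?thesis by simp
qed

text \<open>The matrix on the left is \<open>E B E\<^sup>*\<close>, where \<open>E\<close> is the identity plus the column \<open>c\<close> in position \<open>i\<close>. It
  represents the form of \<open>B\<close> in the coordinates obtained by the shear \<open>w \<mapsto> w + (\<Sum>p. c\<^sub>p w\<^sub>p) e\<^sub>i\<close>.\<close>

lemma det_congruence_shear:
  fixes B :: "complex^'n^'n" and c :: "complex^'n"
  assumes c: "c $ i = 0"
  shows "det (\<chi> p q. B $ p $ q + c $ p * B $ i $ q + cnj (c $ q) * B $ p $ i + c $ p * cnj (c $ q) * B $ i $ i) = det B"
proof -
  define F :: "complex^'n^'n" where "F = (\<chi> p q. (if p = q then 1 else 0) + (if p = i then cnj (c $ q) else 0))"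
  define G :: "complex^'n^'n" where "G = (\<chi> p q. (if p = q then 1 else 0) + (if p = i then c $ q else 0))"
  have "det F = 1"
    using det_shear[of "\<chi> q. cnj (c $ q)" i] c by (simp add: F_def cong: if_cong)
  moreover have "det G = 1"
    using det_shear[of c i] c by (simp add: G_def)
  moreover have "transpose G ** (B ** F) =
      (\<chi> p q. B $ p $ q + c $ p * B $ i $ q + cnj (c $ q) * B $ p $ i + c $ p * cnj (c $ q) * B $ i $ i)"
  proof -
    have d: "(\<Sum>k\<in>UNIV. x k * ((if k = q then 1 else 0) + (if k = i then y else 0))) = x q + x i * y"
      for x :: "'n \<Rightarrow> complex" and y q
    proof -
      have "x k * ((if k = q then 1 else 0) + (if k = i then y else 0)) =
          (if k = q then x q else 0) + (if k = i then x i * y else 0)" for k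
        by (simp add: algebra_simps)
      then show ?thesis by (simp add: sum.distrib)
    qed
    have d': "(\<Sum>k\<in>UNIV. ((if k = p then 1 else 0) + (if k = i then y else 0)) * x k) = x p + y * x i"
      for x :: "'n \<Rightarrow> complex" and y p
      using d[of x p y] by (simp add: mult.commute)
    have BF: "(B ** F) $ k $ q = B $ k $ q + B $ k $ i * cnj (c $ q)" for k q
      by (simp add: matrix_matrix_mult_def F_def d)
    have GM: "(transpose G ** M) $ p $ q = M $ p $ q + c $ p * M $ i $ q" for M :: "complex^'n^'n" and p q
      by (simp add: matrix_matrix_mult_def transpose_def G_def d')
    show ?thesis
      by (simp add: vec_eq_iff GM BF algebra_simps)
  qed
  ultimately show ?thesis
    by (simp add: det_mul flip: \<open>transpose G ** (B ** F) = _\<close>)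
qed

lemma prod_Basis_complex_vec:
  fixes f :: "complex^'n \<Rightarrow> 'b::comm_monoid_mult"
  shows "(\<Prod>b\<in>Basis. f b) = (\<Prod>j\<in>UNIV. f (axis j 1) * f (axis j \<i>))"
proof -
  have B: "(Basis :: (complex^'n) set) = (\<lambda>(j, u). axis j u) ` (UNIV \<times> {1, \<i>})"
    by (auto simp: Basis_vec_def Basis_complex_def)
  have inj: "inj_on (\<lambda>(j, u). axis j u :: complex^'n) (UNIV \<times> {1, \<i>})"
    by (auto simp: inj_on_def axis_eq_axis)
  have "(\<Prod>b\<in>Basis. f b) = (\<Prod>(j, u)\<in>UNIV \<times> {1, \<i>}. f (axis j u))"
    unfolding B by (subst prod.reindex[OF inj]) (simp add: case_prod_beta)
  also have "\<dots> = (\<Prod>j\<in>UNIV. \<Prod>u\<in>{1, \<i>}. f (axis j u))"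
    by (rule prod.cartesian_product[symmetric])
  finally show ?thesis by (simp add: complex_eq_iff)
qed

lemma nn_integral_gaussian_real:
  assumes "0 < d"
  shows "(\<integral>\<^sup>+x. ennreal (exp (- d * x\<^sup>2)) \<partial>lborel) = ennreal (sqrt (pi / d))"
proof -
  define \<sigma> where "\<sigma> = sqrt (1 / (2 * d))"
  have s: "\<sigma> > 0" "\<sigma>\<^sup>2 = 1 / (2 * d)" using assms by (auto simp: \<sigma>_def)
  have "exp (- d * x\<^sup>2) = sqrt (pi / d) * normal_density 0 \<sigma> x" for x
    using assms unfolding normal_density_def s(2) by (simp add: field_simps)
  then have "(\<integral>\<^sup>+x. ennreal (exp (- d * x\<^sup>2)) \<partial>lborel)
      = (\<integral>\<^sup>+x. ennreal (sqrt (pi / d) * normal_density 0 \<sigma> x) \<partial>lborel)"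
    by simp
  also have "\<dots> = ennreal (\<integral>x. sqrt (pi / d) * normal_density 0 \<sigma> x \<partial>lborel)"
    using assms s by (intro nn_integral_eq_integral) (auto intro!: AE_I2 mult_nonneg_nonneg)
  finally show ?thesis using s by simp
qed

lemma nn_integral_gaussian_diagonal:
  fixes d :: "'n::finite \<Rightarrow> real"
  assumes d: "\<And>j. 0 < d j"
  shows "(\<integral>\<^sup>+(w :: complex^'n). ennreal (exp (- (\<Sum>j\<in>UNIV. d j * (cmod (w $ j))\<^sup>2))) \<partial>lborel)
      = ennreal (pi ^ CARD('n) / (\<Prod>j\<in>UNIV. d j))"
proof -
  \<comment> \<open>\<open>D\<close> attaches to both real basis vectors of the \<open>j\<close>-th complex coordinate the coefficient \<open>d\<^sub>j\<close>.\<close>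
  define D :: "complex^'n \<Rightarrow> real" where "D b = (\<Sum>j\<in>UNIV. d j * (cmod (b $ j))\<^sup>2)" for b
  have D: "D (axis j u) = d j" if "cmod u = 1" for j u
  proof -
    have "d k * (cmod (axis j u $ k))\<^sup>2 = (if k = j then d j else 0)" for k
      using that by (auto simp: axis_def)
    then show ?thesis by (simp add: D_def)
  qed
  have "exp (- (\<Sum>j\<in>UNIV. d j * (cmod (w $ j))\<^sup>2)) = (\<Prod>b\<in>Basis. exp (- D b * (w \<bullet> b)\<^sup>2))" for w
  proof -
    have "exp (- (\<Sum>j\<in>UNIV. d j * (cmod (w $ j))\<^sup>2)) = (\<Prod>j\<in>UNIV. exp (- (d j * (cmod (w $ j))\<^sup>2)))"
      by (simp only: sum_negf[symmetric] exp_sum finite)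
    also have "\<dots> = (\<Prod>b\<in>Basis. exp (- D b * (w \<bullet> b)\<^sup>2))"
      unfolding prod_Basis_complex_vec
      by (intro prod.cong refl) (simp add: D inner_axis cmod_power2 algebra_simps flip: exp_add)
    finally show ?thesis .
  qed
  then have "(\<integral>\<^sup>+(w :: complex^'n). ennreal (exp (- (\<Sum>j\<in>UNIV. d j * (cmod (w $ j))\<^sup>2))) \<partial>lborel)
      = (\<integral>\<^sup>+w. (\<Prod>b\<in>Basis. ennreal (exp (- D b * (w \<bullet> b)\<^sup>2))) \<partial>lborel)"
    by (simp add: prod_ennreal)
  also have "\<dots> = (\<Prod>b\<in>Basis. (\<integral>\<^sup>+x. ennreal (exp (- D b * x\<^sup>2)) \<partial>lborel))"
    by (rule nn_integral_lborel_prod) auto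
  also have "\<dots> = (\<Prod>j\<in>UNIV. ennreal (sqrt (pi / d j)) * ennreal (sqrt (pi / d j)))"
    unfolding prod_Basis_complex_vec
    by (simp add: D nn_integral_gaussian_real[OF d, simplified])
  also have "\<dots> = (\<Prod>j\<in>UNIV. ennreal (pi / d j))"
    using d by (intro prod.cong refl) (simp add: less_imp_le flip: ennreal_mult)
  also have "\<dots> = ennreal (\<Prod>j\<in>UNIV. pi / d j)"
    using d by (intro prod_ennreal) (simp add: less_imp_le)
  finally show ?thesis by (simp add: prod_dividef)
qed

text \<open>Completing the square in one variable at a time diagonalises the form by shears, which change
  neither the integral nor the determinant; the diagonal case is a product of one-dimensional
  Gaussian integrals. The induction is on the set \<open>S\<close> of the indices not yet decoupled.\<close>

lemma gaussian_integral:
  fixes B :: "complex^'n^'n"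
  assumes "hermitian_positive B"
  shows "\<exists>d>0. det B = of_real d \<and> (\<integral>\<^sup>+w. ennreal (exp (- Re (sesq B w w))) \<partial>lborel) = ennreal (pi ^ CARD('n) / d)"
proof -
  have "\<exists>d>0. det B = of_real d \<and> (\<integral>\<^sup>+w. ennreal (exp (- Re (sesq B w w))) \<partial>lborel) = ennreal (pi ^ CARD('n) / d)"
    if "finite S" "hermitian_positive B" "\<And>j k. j \<noteq> k \<Longrightarrow> j \<notin> S \<or> k \<notin> S \<Longrightarrow> B $ j $ k = 0"
    for S and B :: "complex^'n^'n"
    using that
  proof (induction S arbitrary: B)
    case empty
    define d where "d j = Re (B $ j $ j)" for j
    have real: "B $ j $ j = of_real (d j)" for j
      using hermitian_positiveD(1)[OF empty.prems(1), of j j] by (simp add: complex_eq_iff d_def)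
    have d: "0 < d j" for j
      using hermitian_positiveD(2)[OF empty.prems(1), of "axis j 1"] by (simp add: sesq_axis_axis d_def axis_eq_0_iff)
    have "Re (sesq B w w) = (\<Sum>j\<in>UNIV. d j * (cmod (w $ j))\<^sup>2)" for w
    proof -
      have "(\<Sum>k\<in>UNIV. B $ j $ k * w $ j * cnj (w $ k)) = (\<Sum>k\<in>UNIV. if k = j then B $ j $ j * w $ j * cnj (w $ j) else 0)" for j
        using empty.prems(2) by (intro sum.cong) auto
      also have "\<dots> j = of_real (d j * (cmod (w $ j))\<^sup>2)" for j
        by (simp add: real mult.assoc complex_norm_square[symmetric])
      finally show ?thesis by (simp add: sesq_def)
    qed
    then have "(\<integral>\<^sup>+w. ennreal (exp (- Re (sesq B w w))) \<partial>lborel) = ennreal (pi ^ CARD('n) / (\<Prod>j\<in>UNIV. d j))"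
      using nn_integral_gaussian_diagonal[OF d] by simp
    moreover have "det B = of_real (\<Prod>j\<in>UNIV. d j)"
      using empty.prems(2) by (subst det_diagonal) (auto simp: real)
    moreover have "(\<Prod>j\<in>UNIV. d j) > 0" using d by (simp add: prod_pos)
    ultimately show ?case by blast
  next
    case (insert i S)
    have cB: "cnj (B $ j $ k) = B $ k $ j" for j k
      by (rule hermitian_positiveD(1)[OF insert.prems(1), symmetric])
    have "B $ i $ i \<noteq> 0"
      using hermitian_positiveD(2)[OF insert.prems(1), of "axis i 1"] by (auto simp: sesq_axis_axis axis_eq_0_iff)
    \<comment> \<open>The shear \<open>T\<close> completes the square in the variable \<open>w\<^sub>i\<close>; in the new coordinates the form \<open>B'\<close> has
        no mixed terms with index \<open>i\<close>.\<close>
    define c where "c = (\<chi> p. if p = i then 0 else - B $ p $ i / B $ i $ i)"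
    define T where "T w = w + axis i (\<Sum>p\<in>UNIV. c $ p * w $ p)" for w
    define B' where "B' = (\<chi> p q. B $ p $ q + c $ p * B $ i $ q + cnj (c $ q) * B $ p $ i + c $ p * cnj (c $ q) * B $ i $ i)"
    have ci: "c $ i = 0" by (simp add: c_def)
    have sesq_B': "sesq B' w w = sesq B (T w) (T w)" for w
    proof -
      have "sesq B' w w = sesq B w w + (\<Sum>p\<in>UNIV. \<Sum>q\<in>UNIV. (c $ p * w $ p) * (B $ i $ q * cnj (w $ q)))
          + (\<Sum>p\<in>UNIV. \<Sum>q\<in>UNIV. (B $ p $ i * w $ p) * (cnj (c $ q) * cnj (w $ q)))
          + (\<Sum>p\<in>UNIV. \<Sum>q\<in>UNIV. (c $ p * w $ p) * (cnj (c $ q) * cnj (w $ q))) * B $ i $ i"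
        unfolding sesq_def B'_def
        by (simp add: sum.distrib sum_distrib_left sum_distrib_right algebra_simps)
      also have "\<dots> = sesq B (T w) (T w)"
        unfolding T_def sesq_add sesq_axis_axis sum_product[symmetric]
        by (simp add: sesq_axis algebra_simps)
      finally show ?thesis .
    qed
    have T: "preserves_volume T"
      unfolding T_def
    proof (rule preserves_volume_complex_shear)
      show "(\<lambda>w. \<Sum>p\<in>UNIV. c $ p * w $ p) \<in> borel_measurable borel"
        by (intro borel_measurable_continuous_onI continuous_intros)
      have *: "c $ p * (x + axis i s) $ p = c $ p * x $ p" for x s p
        using ci by (auto simp: axis_def algebra_simps)
      show "(\<Sum>p\<in>UNIV. c $ p * (x + axis i s) $ p) = (\<Sum>p\<in>UNIV. c $ p * x $ p)" for x s
        by (rule sum.cong[OF refl]) (rule *)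
    qed
    have T0: "w = 0" if "T w = 0" for w
    proof -
      have off: "w $ p = 0" if "p \<noteq> i" for p
      proof -
        have "T w $ p = w $ p" using that by (simp add: T_def axis_def)
        then show ?thesis using \<open>T w = 0\<close> by simp
      qed
      have "c $ p * w $ p = 0" for p
        using off ci by (cases "p = i") auto
      then have "(\<Sum>p\<in>UNIV. c $ p * w $ p) = 0"
        by (intro sum.neutral ballI)
      then have "T w $ i = w $ i" by (simp add: T_def axis_def)
      then have "w $ i = 0" using \<open>T w = 0\<close> by simp
      with off show ?thesis by (metis vec_eq_iff zero_index)
    qed
    have hp: "hermitian_positive B'"
      unfolding hermitian_positive_def
    proof (intro conjI allI impI)
      show "B' $ q $ p = cnj (B' $ p $ q)" for p q
        by (simp add: B'_def cB algebra_simps)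
      show "Re (sesq B' w w) > 0" if "w \<noteq> 0" for w
        unfolding sesq_B' using hermitian_positiveD(2)[OF insert.prems(1)] T0 that by blast
    qed
    have off: "B' $ p $ q = 0" if "p \<noteq> q" "p \<notin> S \<or> q \<notin> S" for p q
    proof -
      have cc: "cnj (c $ q) = (if q = i then 0 else - B $ i $ q / B $ i $ i)"
        by (simp add: c_def cB)
      have cp: "c $ p = (if p = i then 0 else - B $ p $ i / B $ i $ i)"
        by (simp add: c_def)
      consider "p = i" "q \<noteq> i" | "p \<noteq> i" "q = i" | "p \<noteq> i" "q \<noteq> i"
        using \<open>p \<noteq> q\<close> by auto
      then show ?thesis
      proof cases
        case 3
        then have "B $ p $ q = 0" "B $ p $ i = 0 \<or> B $ i $ q = 0"
          using that insert.prems(2)[of p q] insert.prems(2)[of p i] insert.prems(2)[of i q] by auto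
        then show ?thesis
          using 3 by (elim disjE) (simp_all add: B'_def cc cp)
      qed (simp_all add: B'_def cc cp \<open>B $ i $ i \<noteq> 0\<close>)
    qed
    have "det B' = det B"
      unfolding B'_def by (rule det_congruence_shear[OF ci])
    moreover have "(\<integral>\<^sup>+w. ennreal (exp (- Re (sesq B' w w))) \<partial>lborel) = (\<integral>\<^sup>+w. ennreal (exp (- Re (sesq B w w))) \<partial>lborel)"
      unfolding sesq_B' by (rule nn_integral_preserves_volume[OF T, of "\<lambda>w. ennreal (exp (- Re (sesq B w w)))"]) measurable
    ultimately show ?case
      using insert.IH[OF hp off] by simp
  qed
  from this[of UNIV B] assms show ?thesis by simp
qed

section \<open>Holomorphic functions of several variables\<close>

lemma holomorphic_Cn_continuous: "holomorphic_Cn v \<Longrightarrow> continuous_on UNIV v"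
  unfolding holomorphic_Cn_def
  by (meson continuous_at_imp_continuous_on has_derivative_continuous)

lemma holomorphic_Cn_line:
  assumes "holomorphic_Cn v"
  shows "(\<lambda>z. v (x + z *s w)) holomorphic_on UNIV"
proof -
  have "\<exists>D. ((\<lambda>z. v (x + z *s w)) has_field_derivative D) (at z)" for z
  proof -
    obtain a where a: "(v has_derivative (\<lambda>u. \<Sum>j\<in>UNIV. a $ j * u $ j)) (at (x + z *s w))"
      using assms unfolding holomorphic_Cn_def by blast
    have l: "((\<lambda>z. x + z *s w) has_derivative (\<lambda>z. z *s w)) (at z)"
    proof -
      have "bounded_linear (\<lambda>z. z *s w)"
        by (rule linear_conv_bounded_linear[THEN iffD1], rule linearI)
           (auto simp: vec_eq_iff algebra_simps)
      from has_derivative_add[OF has_derivative_const bounded_linear_imp_has_derivative[OF this], of x]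
      show ?thesis by simp
    qed
    have "((\<lambda>z. v (x + z *s w)) has_derivative (\<lambda>t. \<Sum>j\<in>UNIV. a $ j * (t *s w) $ j)) (at z)"
      by (rule has_derivative_compose[OF l a])
    also have "(\<lambda>t. \<Sum>j\<in>UNIV. a $ j * (t *s w) $ j) = (*) (\<Sum>j\<in>UNIV. a $ j * w $ j)"
      by (auto simp: fun_eq_iff sum_distrib_left sum_distrib_right algebra_simps)
    finally show ?thesis
      unfolding has_field_derivative_def by blast
  qed
  then show ?thesis
    by (auto simp: holomorphic_on_def field_differentiable_def)
qed

lemma holomorphic_Cn_const: "holomorphic_Cn (\<lambda>x. c)"
  unfolding holomorphic_Cn_def
proof
  show "\<exists>a. ((\<lambda>x. c) has_derivative (\<lambda>v. \<Sum>j\<in>UNIV. a $ j * v $ j)) (at x)" for x :: "complex^'n"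
    by (intro exI[of _ 0]) simp
qed

lemma holomorphic_Cn_coordinate: "holomorphic_Cn (\<lambda>x :: complex^'n. x $ j)"
  unfolding holomorphic_Cn_def
proof
  fix x :: "complex^'n"
  have "((\<lambda>x :: complex^'n. x $ j) has_derivative (\<lambda>v. v $ j)) (at x)"
    by (rule bounded_linear_imp_has_derivative) (rule bounded_linear_vec_nth)
  moreover have "(\<Sum>k\<in>UNIV. axis j 1 $ k * v $ k) = v $ j" for v :: "complex^'n"
  proof -
    have "axis j 1 $ k * v $ k = (if k = j then v $ j else 0)" for k
      by (auto simp: axis_def)
    then show ?thesis by simp
  qed
  ultimately show "\<exists>a. ((\<lambda>x. x $ j) has_derivative (\<lambda>v. \<Sum>k\<in>UNIV. a $ k * v $ k)) (at x)"
    by (intro exI[of _ "axis j 1"]) simp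
qed

lemma holomorphic_Cn_add:
  assumes "holomorphic_Cn u" "holomorphic_Cn v"
  shows "holomorphic_Cn (\<lambda>x. u x + v x)"
  unfolding holomorphic_Cn_def
proof
  fix x
  obtain a b where "(u has_derivative (\<lambda>v. \<Sum>j\<in>UNIV. a $ j * v $ j)) (at x)"
    "(v has_derivative (\<lambda>v. \<Sum>j\<in>UNIV. b $ j * v $ j)) (at x)"
    using assms unfolding holomorphic_Cn_def by blast
  from has_derivative_add[OF this]
  have "((\<lambda>x. u x + v x) has_derivative (\<lambda>w. \<Sum>j\<in>UNIV. (a + b) $ j * w $ j)) (at x)"
    by (simp add: sum.distrib algebra_simps)
  then show "\<exists>a. ((\<lambda>x. u x + v x) has_derivative (\<lambda>v. \<Sum>j\<in>UNIV. a $ j * v $ j)) (at x)"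
    by blast
qed

lemma holomorphic_Cn_mult:
  assumes "holomorphic_Cn u" "holomorphic_Cn v"
  shows "holomorphic_Cn (\<lambda>x. u x * v x)"
  unfolding holomorphic_Cn_def
proof
  fix x
  obtain a b where "(u has_derivative (\<lambda>v. \<Sum>j\<in>UNIV. a $ j * v $ j)) (at x)"
    "(v has_derivative (\<lambda>v. \<Sum>j\<in>UNIV. b $ j * v $ j)) (at x)"
    using assms unfolding holomorphic_Cn_def by blast
  from has_derivative_mult[OF this]
  have "((\<lambda>x. u x * v x) has_derivative (\<lambda>w. \<Sum>j\<in>UNIV. (\<chi> j. u x * b $ j + a $ j * v x) $ j * w $ j)) (at x)"
    by (simp add: sum_distrib_left sum_distrib_right sum.distrib algebra_simps)
  then show "\<exists>a. ((\<lambda>x. u x * v x) has_derivative (\<lambda>v. \<Sum>j\<in>UNIV. a $ j * v $ j)) (at x)"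
    by blast
qed

lemma holomorphic_Cn_sum:
  "(\<And>i. i \<in> I \<Longrightarrow> holomorphic_Cn (f i)) \<Longrightarrow> holomorphic_Cn (\<lambda>x. \<Sum>i\<in>I. f i x)"
  by (induction I rule: infinite_finite_induct) (auto intro: holomorphic_Cn_const holomorphic_Cn_add)

lemma holomorphic_Cn_exp:
  assumes "holomorphic_Cn u"
  shows "holomorphic_Cn (\<lambda>x. exp (u x))"
  unfolding holomorphic_Cn_def
proof
  fix x
  obtain a where a: "(u has_derivative (\<lambda>v. \<Sum>j\<in>UNIV. a $ j * v $ j)) (at x)"
    using assms unfolding holomorphic_Cn_def by blast
  have "(exp has_derivative (*) (exp (u x))) (at (u x))"
    using DERIV_exp[of "u x"] by (simp add: has_field_derivative_def)
  from has_derivative_compose[OF a this]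
  have "((\<lambda>x. exp (u x)) has_derivative (\<lambda>v. \<Sum>j\<in>UNIV. (\<chi> j. exp (u x) * a $ j) $ j * v $ j)) (at x)"
    by (simp add: sum_distrib_left mult.assoc)
  then show "\<exists>a. ((\<lambda>x. exp (u x)) has_derivative (\<lambda>v. \<Sum>j\<in>UNIV. a $ j * v $ j)) (at x)"
    by blast
qed

lemma holomorphic_Cn_sesq: "holomorphic_Cn (\<lambda>y. sesq B y x)"
  unfolding sesq_def
  by (intro holomorphic_Cn_sum holomorphic_Cn_mult holomorphic_Cn_const holomorphic_Cn_coordinate)

section \<open>The mean value property for Gaussian weights\<close>

lemma circle_mean_value:
  assumes "f holomorphic_on UNIV"
  shows "(\<integral>t. indicator {0..1} t *\<^sub>R f (exp (2 * of_real pi * \<i> * of_real t)) \<partial>lborel) = f 0"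
proof -
  let ?e = "\<lambda>t::real. exp (2 * of_real pi * \<i> * of_real t)"
  have "((\<lambda>u. f u / (u - 0)) has_contour_integral (2 * of_real pi * \<i> * f 0)) (circlepath 0 1)"
    using assms by (intro Cauchy_integral_circlepath_simple) (auto intro: holomorphic_on_subset)
  then have "((\<lambda>t. f (circlepath 0 1 t) / (circlepath 0 1 t - 0) * vector_derivative (circlepath 0 1) (at t within {0..1}))
      has_integral (2 * of_real pi * \<i> * f 0)) {0..1}"
    by (simp add: has_contour_integral_def)
  then have "((\<lambda>t. (2 * of_real pi * \<i>) * f (?e t)) has_integral (2 * of_real pi * \<i> * f 0)) {0..1}"
    by (rule has_integral_eq[rotated]) (simp add: vector_derivative_circlepath01, simp add: circlepath)
  from has_integral_mult_right[OF this, of "1 / (2 * of_real pi * \<i>)"]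
  have "((\<lambda>t. f (?e t)) has_integral f 0) {0..1}" by simp
  moreover have "continuous_on {0..1} (\<lambda>t. f (?e t))"
    by (rule continuous_on_compose2[OF holomorphic_on_imp_continuous_on[OF assms]]) (auto intro!: continuous_intros)
  then have "set_integrable lborel {0..1} (\<lambda>t. f (?e t))"
    by (rule borel_integrable_atLeastAtMost')
  ultimately show ?thesis
    using set_borel_integral_eq_integral(2)[of "{0..1}" "\<lambda>t. f (?e t)"]
    by (simp add: set_lebesgue_integral_def integral_unique)
qed

lemma continuous_on_vector_scalar_mult [continuous_intros]:
  fixes g :: "'a::topological_space \<Rightarrow> complex^'n"
  shows "continuous_on A f \<Longrightarrow> continuous_on A g \<Longrightarrow> continuous_on A (\<lambda>x. f x *s g x)"
  unfolding vector_scalar_mult_def by (intro continuous_intros continuous_on_vec_lambda)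

text \<open>The Gaussian integral of \<open>w \<mapsto> g(exp (2\<pi>\<i>t) w)\<close> does not depend on \<open>t\<close>, because the rotation preserves
  volume and the weight. Averaging over \<open>t\<close> inside the integral replaces \<open>g\<close> by \<open>g(0)\<close>, by Cauchy's
  formula on the line through \<open>w\<close>.\<close>

lemma gaussian_mean_value:
  fixes g :: "complex^'n \<Rightarrow> complex"
  assumes cont: "continuous_on UNIV g"
    and hol: "\<And>w. (\<lambda>z. g (z *s w)) holomorphic_on UNIV"
    and int: "integrable lborel (\<lambda>w. g w * of_real (exp (- Re (sesq B w w))))"
  shows "(\<integral>w. g w * of_real (exp (- Re (sesq B w w))) \<partial>lborel)
      = g 0 * of_real (\<integral>w. exp (- Re (sesq B w w)) \<partial>lborel)"
proof -
  let ?e = "\<lambda>t::real. exp (2 * of_real pi * \<i> * of_real t) :: complex"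
  let ?G = "\<lambda>w. g w * of_real (exp (- Re (sesq B w w)))"
  \<comment> \<open>The indicator of the period turns the average over \<open>t\<close> into an integral over the whole line, so that
      Fubini's theorem applies to Lebesgue measure in both variables.\<close>
  define F where "F t w = indicator {0..1} t *\<^sub>R (g (?e t *s w) * of_real (exp (- Re (sesq B w w))))" for t w
  have e1: "cmod (?e t) = 1" for t by simp
  have inv: "sesq B (?e t *s w) (?e t *s w) = sesq B w w" for t w
  proof -
    have "?e t * cnj (?e t) = 1"
      by (metis complex_norm_square e1 of_real_1 one_power2)
    then have "cnj (?e t) * ?e t = 1" by (simp only: mult.commute)
    then show ?thesis by (simp add: sesq_scale flip: mult.assoc)
  qed
  have FG: "F t w = indicator {0..1} t *\<^sub>R ?G (?e t *s w)" for t w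
    by (simp add: F_def inv)
  have Gm [measurable]: "?G \<in> borel_measurable borel"
    using int by simp
  have gm: "g \<in> borel_measurable borel"
    using cont by (rule borel_measurable_continuous_onI)
  have rot: "preserves_volume (\<lambda>w :: complex^'n. ?e t *s w)" for t
    by (rule preserves_volume_rotate[OF e1])
  have Fint: "integrable lborel (F t)" for t
  proof -
    have "integrable (distr lborel borel (\<lambda>w. ?e t *s w)) ?G"
      using rot[of t] int by (simp add: preserves_volume_def)
    then have "integrable lborel (\<lambda>w. ?G (?e t *s w))"
      by (rule integrable_distr[rotated]) (use rot[of t] in \<open>simp add: preserves_volume_def\<close>)
    then show ?thesis unfolding FG[abs_def] by simp
  qed
  have Fval: "(\<integral>w. F t w \<partial>lborel) = indicator {0..1} t *\<^sub>R (\<integral>w. ?G w \<partial>lborel)" for t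
    unfolding FG integral_scaleR_right
    using integral_preserves_volume[OF rot Gm] by simp
  have Fnorm: "(\<integral>w. norm (F t w) \<partial>lborel) = indicator {0..1} t * (\<integral>w. cmod (?G w) \<partial>lborel)" for t
  proof -
    have "(\<integral>w. cmod (?G (?e t *s w)) \<partial>lborel) = (\<integral>w. cmod (?G w) \<partial>distr lborel borel (\<lambda>w. ?e t *s w))"
      using rot[of t] by (subst integral_distr) (auto simp: preserves_volume_def)
    also have "distr lborel borel (\<lambda>w :: complex^'n. ?e t *s w) = lborel"
      using rot[of t] by (simp add: preserves_volume_def)
    finally show ?thesis unfolding FG norm_scaleR by simp
  qed
  have [measurable]: "(\<lambda>(t, w). F t w) \<in> borel_measurable (lborel \<Otimes>\<^sub>M lborel)"
  proof -
    have "(\<lambda>p :: real \<times> (complex^'n). ?e (fst p) *s snd p) \<in> borel_measurable borel"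
      by (intro borel_measurable_continuous_onI continuous_intros)
    then have [measurable]: "(\<lambda>p. ?e (fst p) *s snd p) \<in> borel_measurable (lborel \<Otimes>\<^sub>M (lborel :: (complex^'n) measure))"
      by (simp add: lborel_prod)
    have [measurable]: "(\<lambda>p. g (?e (fst p) *s snd p)) \<in> borel_measurable (lborel \<Otimes>\<^sub>M lborel)"
      by (rule measurable_compose[OF _ gm]) measurable
    show ?thesis
      unfolding F_def case_prod_beta by measurable
  qed
  have "integrable (lborel \<Otimes>\<^sub>M lborel) (\<lambda>(t, w). F t w)"
  proof (rule lborel_pair.Fubini_integrable)
    show "integrable lborel (\<lambda>t. \<integral>w. norm (case (t, w) of (t, w) \<Rightarrow> F t w) \<partial>lborel)"
      by (simp add: Fnorm)
    show "AE t in lborel. integrable lborel (\<lambda>w. case (t, w) of (t, w) \<Rightarrow> F t w)"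
      using Fint by simp
  qed measurable
  then have swap: "(\<integral>w. (\<integral>t. F t w \<partial>lborel) \<partial>lborel) = (\<integral>t. (\<integral>w. F t w \<partial>lborel) \<partial>lborel)"
    by (rule lborel_pair.Fubini_integral)
  have inner: "(\<integral>t. F t w \<partial>lborel) = g 0 * of_real (exp (- Re (sesq B w w)))" for w
  proof -
    have "F t w = (indicator {0..1} t *\<^sub>R g (?e t *s w)) * of_real (exp (- Re (sesq B w w)))" for t
      by (simp add: F_def)
    then show ?thesis
      by (simp only: integral_mult_left_zero circle_mean_value[OF hol[of w]] vector_smult_lzero)
  qed
  have "(\<integral>w. ?G w \<partial>lborel) = (\<integral>t. (\<integral>w. F t w \<partial>lborel) \<partial>lborel)"
    by (simp add: Fval)
  also have "\<dots> = (\<integral>w. g 0 * of_real (exp (- Re (sesq B w w))) \<partial>lborel)"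
    unfolding swap[symmetric] inner ..
  also have "\<dots> = g 0 * of_real (\<integral>w. exp (- Re (sesq B w w)) \<partial>lborel)"
    by (simp only: integral_mult_right_zero integral_complex_of_real)
  finally show ?thesis .
qed

section \<open>Square-integrable functions for a Gaussian weight\<close>

lemma sesq_bound: "\<exists>M\<ge>0. \<forall>x y. cmod (sesq B x y) \<le> M * norm x * norm y"
proof (intro exI conjI allI)
  let ?M = "\<Sum>j\<in>UNIV. \<Sum>k\<in>UNIV. cmod (B $ j $ k)"
  show "?M \<ge> 0" by (intro sum_nonneg) auto
  show "cmod (sesq B x y) \<le> ?M * norm x * norm y" for x y
  proof -
    have "cmod (sesq B x y) \<le> (\<Sum>j\<in>UNIV. \<Sum>k\<in>UNIV. cmod (B $ j $ k * x $ j * cnj (y $ k)))"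
      unfolding sesq_def by (intro sum_norm_le order.refl)
    also have "\<dots> \<le> (\<Sum>j\<in>UNIV. \<Sum>k\<in>UNIV. cmod (B $ j $ k) * norm x * norm y)"
      by (intro sum_mono) (auto simp: norm_mult intro!: mult_mono Finite_Cartesian_Product.norm_nth_le)
    finally show ?thesis by (simp add: sum_distrib_right)
  qed
qed

lemma positive_quadratic_lower_bound:
  fixes S :: "'a::euclidean_space \<Rightarrow> real"
  assumes cont: "continuous_on UNIV S" and scale: "\<And>t y. S (t *\<^sub>R y) = t\<^sup>2 * S y"
    and pos: "\<And>y. y \<noteq> 0 \<Longrightarrow> S y > 0"
  shows "\<exists>\<kappa>>0. \<forall>y. \<kappa> * (norm y)\<^sup>2 \<le> S y"
proof -
  have "\<exists>e\<in>sphere 0 1. \<forall>y\<in>sphere 0 1. S e \<le> S y"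
    by (rule continuous_attains_inf) (auto intro: continuous_on_subset[OF cont])
  then obtain e where e: "norm e = 1" "\<And>y. norm y = 1 \<Longrightarrow> S e \<le> S y" by auto
  have "S e * (norm y)\<^sup>2 \<le> S y" for y
  proof (cases "y = 0")
    case True
    then show ?thesis using scale[of 0 0] by simp
  next
    case False
    have "S y = S (norm y *\<^sub>R ((1 / norm y) *\<^sub>R y))" using False by simp
    also have "\<dots> = (norm y)\<^sup>2 * S ((1 / norm y) *\<^sub>R y)" by (rule scale)
    also have "\<dots> \<ge> (norm y)\<^sup>2 * S e"
      using e(2)[of "(1 / norm y) *\<^sub>R y"] False by (intro mult_left_mono) auto
    finally show ?thesis by (simp add: mult.commute)
  qed
  moreover have "e \<noteq> 0" using e(1) by auto
  ultimately show ?thesis using pos by blast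
qed

lemma hermitian_positive_lower_bound:
  assumes "hermitian_positive B"
  shows "\<exists>q>0. \<forall>w. q * (norm w)\<^sup>2 \<le> Re (sesq B w w)"
proof (rule positive_quadratic_lower_bound)
  show "continuous_on UNIV (\<lambda>w. Re (sesq B w w))"
    by (intro continuous_intros)
  show "Re (sesq B (t *\<^sub>R w) (t *\<^sub>R w)) = t\<^sup>2 * Re (sesq B w w)" for t w
  proof -
    have "t *\<^sub>R w = of_real t *s w"
      by (simp add: vec_eq_iff scaleR_conv_of_real[where 'a=complex])
    then show ?thesis by (simp add: sesq_scale power2_eq_square)
  qed
qed (rule hermitian_positiveD(2)[OF assms])

lemma integrable_exp_linear_gaussian:
  assumes "hermitian_positive (B :: complex^'n^'n)" "s > 0"
  shows "integrable lborel (\<lambda>w. exp (m * norm w - s * Re (sesq B w w)))"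
proof -
  obtain q where q: "q > 0" "\<And>w. q * (norm w)\<^sup>2 \<le> Re (sesq B w w)"
    using hermitian_positive_lower_bound[OF assms(1)] by blast
  \<comment> \<open>Half of the quadratic decay \<open>s q |w|\<^sup>2\<close> absorbs the linear term, the other half is integrable.\<close>
  define r where "r = s * q / 2"
  have r: "r > 0" using q assms by (simp add: r_def)
  have norm2: "(norm w)\<^sup>2 = (\<Sum>j\<in>UNIV. (cmod (w $ j))\<^sup>2)" for w :: "complex^'n"
    by (simp add: norm_vec_def L2_set_def sum_nonneg)
  have "(\<integral>\<^sup>+(w::complex^'n). ennreal (exp (- r * (norm w)\<^sup>2)) \<partial>lborel) < \<infinity>"
    using nn_integral_gaussian_diagonal[of "\<lambda>_::'n. r"] r by (simp add: norm2 sum_distrib_left sum_negf)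
  then have int: "integrable lborel (\<lambda>w :: complex^'n. exp (- r * (norm w)\<^sup>2))"
    by (intro integrableI_bounded) auto
  have bound: "m * norm w - s * Re (sesq B w w) \<le> m\<^sup>2 / (4 * r) - r * (norm w)\<^sup>2" for w
  proof -
    have "s * Re (sesq B w w) \<ge> 2 * r * (norm w)\<^sup>2"
      using mult_left_mono[OF q(2)[of w], of s] assms by (simp add: r_def)
    moreover have "m * norm w \<le> m\<^sup>2 / (4 * r) + r * (norm w)\<^sup>2"
    proof -
      have "0 \<le> (m - 2 * r * norm w)\<^sup>2 / (4 * r)" using r by simp
      also have "\<dots> = m\<^sup>2 / (4 * r) + r * (norm w)\<^sup>2 - m * norm w"
        using r by (simp add: field_simps power2_eq_square)
      finally show ?thesis by simp
    qed
    ultimately show ?thesis by simp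
  qed
  have "exp (m * norm w - s * Re (sesq B w w)) \<le> exp (m\<^sup>2 / (4 * r)) * exp (- r * (norm w)\<^sup>2)" for w
    unfolding exp_add[symmetric] using bound[of w] by simp
  then show ?thesis
    by (intro Bochner_Integration.integrable_bound[OF integrable_mult_right[OF int, of "exp (m\<^sup>2 / (4 * r))"]]) auto
qed

definition gaussian_L2 :: "complex^'n^'n \<Rightarrow> (complex^'n \<Rightarrow> complex) set" where
  "gaussian_L2 B = {u \<in> borel_measurable lebesgue. integrable lebesgue (\<lambda>y. (cmod (u y))\<^sup>2 * exp (- Re (sesq B y y)))}"

lemma gaussian_L2_measurable: "u \<in> gaussian_L2 B \<Longrightarrow> u \<in> borel_measurable lebesgue"
  by (simp add: gaussian_L2_def)

lemma gaussian_L2_integrable_product: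
  fixes F :: "complex^'n \<Rightarrow> 'b::{banach, second_countable_topology}"
  assumes u: "u \<in> gaussian_L2 B" and v: "v \<in> gaussian_L2 B"
    and [measurable]: "F \<in> borel_measurable lebesgue"
    and le: "\<And>y. norm (F y) \<le> K * (cmod (u y) * cmod (v y) * exp (- Re (sesq B y y)))"
  shows "integrable lebesgue F"
proof -
  have "integrable lebesgue (\<lambda>y. \<bar>K\<bar> * ((cmod (u y))\<^sup>2 * exp (- Re (sesq B y y)) + (cmod (v y))\<^sup>2 * exp (- Re (sesq B y y))))"
    using u v by (simp add: gaussian_L2_def)
  then show ?thesis
  proof (rule Bochner_Integration.integrable_bound)
    show "AE y in lebesgue. norm (F y) \<le> norm (\<bar>K\<bar> * ((cmod (u y))\<^sup>2 * exp (- Re (sesq B y y)) + (cmod (v y))\<^sup>2 * exp (- Re (sesq B y y))))"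
    proof (rule AE_I2)
      fix y
      have "cmod (u y) * cmod (v y) \<le> (cmod (u y))\<^sup>2 + (cmod (v y))\<^sup>2"
        using sum_squares_bound[of "cmod (u y)" "cmod (v y)"] mult_nonneg_nonneg[OF norm_ge_zero norm_ge_zero, of "u y" "v y"] by linarith
      then have "\<bar>K\<bar> * ((cmod (u y) * cmod (v y)) * exp (- Re (sesq B y y))) \<le> \<bar>K\<bar> * (((cmod (u y))\<^sup>2 + (cmod (v y))\<^sup>2) * exp (- Re (sesq B y y)))"
        by (intro mult_left_mono mult_right_mono) auto
      moreover have "K * (cmod (u y) * cmod (v y) * exp (- Re (sesq B y y))) \<le> \<bar>K\<bar> * ((cmod (u y) * cmod (v y)) * exp (- Re (sesq B y y)))"
        by (intro mult_right_mono) auto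
      moreover note le[of y]
      ultimately show "norm (F y) \<le> norm (\<bar>K\<bar> * ((cmod (u y))\<^sup>2 * exp (- Re (sesq B y y)) + (cmod (v y))\<^sup>2 * exp (- Re (sesq B y y))))"
        by (simp add: algebra_simps)
    qed
  qed measurable
qed

lemma measurable_lebesgue_continuous:
  "continuous_on UNIV f \<Longrightarrow> f \<in> borel_measurable lebesgue"
  for f :: "'a::euclidean_space \<Rightarrow> 'b::topological_space"
  by (intro measurable_completion) (simp add: borel_measurable_continuous_onI)

lemma exp_norm_in_gaussian_L2:
  assumes "hermitian_positive B"
  shows "(\<lambda>y. of_real (exp (m * norm y))) \<in> gaussian_L2 B"
proof -
  have "(cmod (of_real (exp (m * norm y))))\<^sup>2 * exp (- Re (sesq B y y)) = exp (2 * m * norm y - 1 * Re (sesq B y y))" for y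
    by (simp add: exp_diff exp_minus divide_inverse power2_eq_square exp_add[symmetric])
  moreover have "integrable lebesgue (\<lambda>y. exp (2 * m * norm y - 1 * Re (sesq B y y)))"
    using integrable_exp_linear_gaussian[OF assms, of 1 "2 * m"] by (subst integrable_completion) simp_all
  ultimately show ?thesis
    unfolding gaussian_L2_def
    by (auto intro!: measurable_lebesgue_continuous continuous_intros)
qed

text \<open>The kernel and its derivatives grow at most like \<open>exp (m |y|)\<close>, which is itself square-integrable for the
  Gaussian weight.\<close>

lemma gaussian_L2_integrable_exp_growth:
  fixes F :: "complex^'n \<Rightarrow> 'b::{banach, second_countable_topology}"
  assumes B: "hermitian_positive B" and u: "u \<in> gaussian_L2 B"
    and F: "F \<in> borel_measurable lebesgue"
    and le: "\<And>y. norm (F y) \<le> K * (exp (m * norm y) * cmod (u y) * exp (- Re (sesq B y y)))"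
  shows "integrable lebesgue F"
  by (rule gaussian_L2_integrable_product[OF exp_norm_in_gaussian_L2[OF B, of m] u F, of K]) (use le in simp)

lemma exp_sesq_bound:
  shows "\<exists>M\<ge>0. \<forall>x y. cmod (sesq B x y) \<le> M * norm x * norm y \<and> cmod (exp (sesq B x y)) \<le> exp (M * norm x * norm y)"
proof -
  obtain M where M: "M \<ge> 0" "\<And>x y. cmod (sesq B x y) \<le> M * norm x * norm y"
    using sesq_bound[of B] by blast
  have "cmod (exp (sesq B x y)) \<le> exp (M * norm x * norm y)" for x y
    using order_trans[OF complex_Re_le_cmod M(2)] by simp
  with M show ?thesis by blast
qed

lemma kernel_integrable:
  assumes B: "hermitian_positive B" and u: "u \<in> gaussian_L2 B"
  shows "integrable lebesgue (\<lambda>y. exp (sesq B x y) * u y * of_real (exp (- Re (sesq B y y))))"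
proof -
  obtain M where M: "\<And>x y. cmod (exp (sesq B x y)) \<le> exp (M * norm x * norm y)"
    using exp_sesq_bound[of B] by blast
  note [measurable] = gaussian_L2_measurable[OF u]
  have [measurable]: "(\<lambda>y. exp (sesq B x y)) \<in> borel_measurable lebesgue"
    "(\<lambda>y. complex_of_real (exp (- Re (sesq B y y)))) \<in> borel_measurable lebesgue"
    by (auto intro!: measurable_lebesgue_continuous continuous_intros)
  show ?thesis
    by (rule gaussian_L2_integrable_exp_growth[OF B u, of _ 1 "M * norm x"])
       (use M[of x] in \<open>auto simp: norm_mult intro!: mult_right_mono\<close>)
qed

section \<open>The reproducing property\<close>

text \<open>The constant is the reciprocal of the Gaussian integral, so that the constant function \<open>1\<close> has the value \<open>1\<close>
  at the origin.\<close>

definition bergman_operator :: "complex^'n^'n \<Rightarrow> (complex^'n \<Rightarrow> complex) \<Rightarrow> complex^'n \<Rightarrow> complex" where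
  "bergman_operator B u x = det B / of_real (pi ^ CARD('n)) *
     (\<integral>y. exp (sesq B x y) * u y * of_real (exp (- Re (sesq B y y))) \<partial>lebesgue)"

text \<open>For \<open>y = x + w\<close> the exponent \<open>b(x, y) - b(y, y)\<close> equals \<open>- b(w, x) - b(w, w)\<close>, and \<open>b(w, x)\<close> is
  holomorphic in \<open>w\<close>; the Gaussian mean value property evaluates the integral.\<close>

lemma reproducing_property:
  fixes B :: "complex^'n^'n"
  assumes B: "hermitian_positive B" and v: "v \<in> gaussian_L2 B" and hol: "holomorphic_Cn v"
  shows "bergman_operator B v x = v x"
proof -
  let ?f = "\<lambda>y. exp (sesq B x y) * v y * of_real (exp (- Re (sesq B y y)))"
  define g where "g w = exp (- sesq B w x) * v (x + w)" for w
  have vc: "continuous_on A (\<lambda>w. v (f w))" if "continuous_on A f" for A and f :: "complex^'n \<Rightarrow> complex^'n"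
    using continuous_on_compose2[OF holomorphic_Cn_continuous[OF hol] that] by auto
  have gc: "continuous_on UNIV g"
    unfolding g_def by (intro continuous_intros vc)
  have ghol: "(\<lambda>z. g (z *s w)) holomorphic_on UNIV" for w
    unfolding g_def sesq_scale using holomorphic_Cn_line[OF hol] by (intro holomorphic_intros)
  have fc: "continuous_on UNIV ?f"
    by (intro continuous_intros vc)
  then have fm: "?f \<in> borel_measurable borel"
    by (rule borel_measurable_continuous_onI)
  have fi: "integrable lborel ?f"
    using kernel_integrable[OF B v, of x] fm by (simp add: integrable_completion)
  have shift: "?f (x + w) = g w * of_real (exp (- Re (sesq B w w)))" for w
  proof -
    have real: "of_real (Re (sesq B y y)) = sesq B y y" for y
      using sesq_cnj[OF B, of y y] by (simp add: complex_eq_iff)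
    have "?f (x + w) = exp (sesq B x (x + w) - sesq B (x + w) (x + w)) * v (x + w)"
      by (simp add: exp_diff exp_minus exp_of_real[symmetric] real divide_inverse)
    also have "sesq B x (x + w) - sesq B (x + w) (x + w) = - sesq B w x - sesq B w w"
      by (simp add: sesq_add)
    also have "exp \<dots> * v (x + w) = g w * of_real (exp (- Re (sesq B w w)))"
      by (simp add: g_def exp_diff exp_minus exp_of_real[symmetric] real divide_inverse)
    finally show ?thesis .
  qed
  note tr = preserves_volume_translate[of x, unfolded preserves_volume_def]
  have "integrable (distr lborel borel (\<lambda>w. x + w)) ?f"
    using tr fi by simp
  then have "integrable lborel (\<lambda>w. ?f (x + w))"
    by (rule integrable_distr[rotated]) (use tr in simp)
  then have gi: "integrable lborel (\<lambda>w. g w * of_real (exp (- Re (sesq B w w))))"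
    unfolding shift .
  have "(\<integral>y. ?f y \<partial>lebesgue) = (\<integral>w. ?f (x + w) \<partial>lborel)"
    using integral_preserves_volume[OF preserves_volume_translate[of x] fm] fm
    by (simp add: integral_completion)
  also have "\<dots> = g 0 * of_real (\<integral>w. exp (- Re (sesq B w w)) \<partial>lborel)"
    unfolding shift by (rule gaussian_mean_value[OF gc ghol gi])
  also have "g 0 = v x" by (simp add: g_def)
  finally have *: "(\<integral>y. ?f y \<partial>lebesgue) = v x * of_real (\<integral>w. exp (- Re (sesq B w w)) \<partial>lborel)" .
  obtain d where d: "d > 0" "det B = of_real d"
    "(\<integral>\<^sup>+w. ennreal (exp (- Re (sesq B w w))) \<partial>lborel) = ennreal (pi ^ CARD('n) / d)"
    using gaussian_integral[OF B] by blast
  have "(\<integral>w. exp (- Re (sesq B w w)) \<partial>lborel) = pi ^ CARD('n) / d"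
    by (rule integral_eq_nn_integral[THEN trans]) (use d in auto)
  then show ?thesis
    unfolding bergman_operator_def * using d by simp
qed

section \<open>The Bergman operator as an orthogonal projection\<close>

lemma sigma_finite_lebesgue: "sigma_finite_measure (lebesgue :: 'a::euclidean_space measure)"
proof
  obtain A :: "'a set set" where A: "countable A" "A \<subseteq> sets lborel" "\<Union>A = space lborel" "\<And>a. a \<in> A \<Longrightarrow> emeasure lborel a \<noteq> \<infinity>"
    using sigma_finite_lborel unfolding sigma_finite_measure_def by metis
  have "emeasure lebesgue a = emeasure lborel a" if "a \<in> A" for a
  proof -
    have a: "a \<in> sets lborel" "a \<in> sets lebesgue"
      using A(2) that sets_completionI_sets by blast+
    show ?thesis
      using nn_integral_completion[of lborel "indicator a"]
      unfolding nn_integral_indicator[OF a(1)] nn_integral_indicator[OF a(2)] .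
  qed
  moreover have "A \<subseteq> sets lebesgue"
    using A(2) sets_completionI_sets by blast
  ultimately show "\<exists>A. countable A \<and> A \<subseteq> sets lebesgue \<and> \<Union>A = space (lebesgue :: 'a measure) \<and> (\<forall>a\<in>A. emeasure lebesgue a \<noteq> \<infinity>)"
    using A by (intro exI[of _ A] conjI ballI) (auto simp del: emeasure_completion)
qed

text \<open>Lebesgue-measurable functions are integrated against continuous kernels on the product of two
  completed measures; these rules let Borel functions of the coordinates be recognised as measurable there.\<close>

lemma measurable_ident_lebesgue [measurable]:
  "(\<lambda>x. x) \<in> borel_measurable lebesgue"
  "fst \<in> borel_measurable (lebesgue \<Otimes>\<^sub>M M)" "snd \<in> borel_measurable (M \<Otimes>\<^sub>M lebesgue)"
proof -
  have *: "(\<lambda>x. x) \<in> borel_measurable lebesgue"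
    by (intro measurable_completion) simp
  show "(\<lambda>x. x) \<in> borel_measurable lebesgue" by (rule *)
  show "fst \<in> borel_measurable (lebesgue \<Otimes>\<^sub>M M)"
    by (rule measurable_compose[OF measurable_fst *])
  show "snd \<in> borel_measurable (M \<Otimes>\<^sub>M lebesgue)"
    by (rule measurable_compose[OF measurable_snd *])
qed

lemma Re_sesq_polarize:
  assumes "hermitian_positive B"
  shows "Re (sesq B (x - y) (x - y)) = Re (sesq B x x) + Re (sesq B y y) - 2 * Re (sesq B x y)"
  using sesq_cnj[OF assms, of x y] by (simp add: sesq_diff)

lemma gaussian_kernel_finite:
  fixes B :: "complex^'n^'n"
  assumes "hermitian_positive B"
  shows "(\<integral>\<^sup>+w. ennreal (exp (- (Re (sesq B w w) / 2))) \<partial>lborel) < \<infinity>"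
  using integrable_exp_linear_gaussian[OF assms, of "1/2" 0] by (simp add: integrable_iff_bounded)

text \<open>Convolution with the Gaussian multiplies the total mass by the Gaussian integral, which makes the
  absolute bounds for the Bergman operator finite.\<close>

lemma nn_integral_gaussian_kernel:
  fixes B :: "complex^'n^'n" and f :: "complex^'n \<Rightarrow> ennreal"
  assumes [measurable]: "f \<in> borel_measurable lebesgue"
  shows "(\<integral>\<^sup>+x. (\<integral>\<^sup>+y. ennreal (exp (- (Re (sesq B (x - y) (x - y)) / 2))) * f y \<partial>lebesgue) \<partial>lebesgue)
    = (\<integral>\<^sup>+w. ennreal (exp (- (Re (sesq B w w) / 2))) \<partial>lborel) * (\<integral>\<^sup>+y. f y \<partial>lebesgue)"
proof -
  interpret pair_sigma_finite "lebesgue :: (complex^'n) measure" "lebesgue :: (complex^'n) measure"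
    by (intro pair_sigma_finite.intro sigma_finite_lebesgue)
  let ?E = "\<lambda>w. ennreal (exp (- (Re (sesq B w w) / 2)))"
  have Em: "?E \<in> borel_measurable borel" by measurable
  have [measurable]: "(\<lambda>p :: (complex^'n) \<times> (complex^'n). exp (- (Re (sesq B (fst p - snd p) (fst p - snd p)) / 2))) \<in> borel_measurable (lebesgue \<Otimes>\<^sub>M lebesgue)"
    by measurable
  have "(\<integral>\<^sup>+x. (\<integral>\<^sup>+y. ?E (x - y) * f y \<partial>lebesgue) \<partial>lebesgue) = (\<integral>\<^sup>+y. (\<integral>\<^sup>+x. ?E (x - y) * f y \<partial>lebesgue) \<partial>lebesgue)"
    by (rule Fubini'[symmetric]) (unfold case_prod_beta, measurable)
  also have "\<dots> = (\<integral>\<^sup>+y. (\<integral>\<^sup>+w. ?E w \<partial>lborel) * f y \<partial>lebesgue)"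
  proof (intro nn_integral_cong)
    fix y
    have "(\<integral>\<^sup>+x. ?E (x - y) * f y \<partial>lebesgue) = (\<integral>\<^sup>+x. ?E (- y + x) * f y \<partial>lborel)"
      by (simp add: nn_integral_completion)
    also have "\<dots> = (\<integral>\<^sup>+x. ?E (- y + x) \<partial>lborel) * f y"
      by (rule nn_integral_multc, rule measurable_compose[OF _ Em]) simp
    also have "(\<integral>\<^sup>+x. ?E (- y + x) \<partial>lborel) = (\<integral>\<^sup>+x. ?E x \<partial>lborel)"
      by (rule nn_integral_preserves_volume[OF preserves_volume_translate Em])
    finally show "(\<integral>\<^sup>+x. ?E (x - y) * f y \<partial>lebesgue) = (\<integral>\<^sup>+w. ?E w \<partial>lborel) * f y" .
  qed
  also have "\<dots> = (\<integral>\<^sup>+w. ?E w \<partial>lborel) * (\<integral>\<^sup>+y. f y \<partial>lebesgue)"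
    by (rule nn_integral_cmult) measurable
  finally show ?thesis .
qed

text \<open>Splitting the Gaussian weight into \<open>exp (- b(x, x) / 2)\<close> and \<open>exp (- b(y, y) / 2)\<close> makes the modulus of the kernel a
  function of \<open>x - y\<close> that decays like a Gaussian.\<close>

lemma kernel_norm:
  assumes "hermitian_positive B"
  shows "cmod (exp (sesq B x y) * u * of_real (exp (- Re (sesq B y y)))) * exp (- (Re (sesq B x x) / 2))
    = exp (- (Re (sesq B (x - y) (x - y)) / 2)) * (cmod u * exp (- (Re (sesq B y y) / 2)))"
proof -
  have "exp (Re (sesq B x y)) * exp (- Re (sesq B y y)) * exp (- (Re (sesq B x x) / 2))
      = exp (- (Re (sesq B (x - y) (x - y)) / 2)) * exp (- (Re (sesq B y y) / 2))"
    unfolding exp_add[symmetric] Re_sesq_polarize[OF assms] by (simp add: field_simps)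
  then show ?thesis
    by (simp add: norm_mult mult_ac)
qed

text \<open>The first-order Taylor remainder of \<open>exp (b(x + v, y))\<close> in \<open>v\<close> is at most \<open>|v|\<^sup>2\<close> times an exponential in
  \<open>|y|\<close> for \<open>|v| \<le> 1\<close>, so the remainder of the integral is quadratic in \<open>v\<close>.\<close>

lemma holomorphic_integral_exp_sesq:
  fixes B :: "complex^'n^'n" and G :: "complex^'n \<Rightarrow> complex"
  assumes [measurable]: "G \<in> borel_measurable lebesgue"
    and G: "\<And>m. integrable lebesgue (\<lambda>y. exp (m * norm y) * cmod (G y))"
  shows "holomorphic_Cn (\<lambda>x. \<integral>y. exp (sesq B x y) * G y \<partial>lebesgue)"
  unfolding holomorphic_Cn_def
proof
  fix x
  obtain M where M: "M \<ge> 0" "\<And>x y. cmod (sesq B x y) \<le> M * norm x * norm y"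
    "\<And>x y. cmod (exp (sesq B x y)) \<le> exp (M * norm x * norm y)"
    using exp_sesq_bound[of B] by blast
  have sm [measurable]: "(\<lambda>y. sesq B x y) \<in> borel_measurable lebesgue" for x
    by (intro measurable_lebesgue_continuous continuous_intros)
  have dom: "integrable lebesgue F" if "F \<in> borel_measurable lebesgue"
    "\<And>y. cmod (F y) \<le> K * (exp (m * norm y) * cmod (G y))" for F :: "complex^'n \<Rightarrow> complex" and K m
  proof (rule Bochner_Integration.integrable_bound[OF integrable_mult_right[OF G, of "K" m]])
    show "AE y in lebesgue. norm (F y) \<le> norm (K * (exp (m * norm y) * cmod (G y)))"
      using that(2) by (intro AE_I2) (metis abs_ge_self order_trans real_norm_def)
  qed fact
  have int0: "integrable lebesgue (\<lambda>y. exp (sesq B x y) * G y)" for x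
    by (rule dom[of _ 1 "M * norm x"]) (use M(3)[of x] in \<open>auto simp: norm_mult intro!: mult_right_mono\<close>)
  have int1: "integrable lebesgue (\<lambda>y. sesq B v y * (exp (sesq B x y) * G y))" for v
  proof (rule dom[of _ 1 "M * norm v + M * norm x"])
    fix y
    have "cmod (sesq B v y) \<le> exp (M * norm v * norm y)"
      using M(2)[of v y] exp_ge_add_one_self[of "M * norm v * norm y"] by linarith
    then have "cmod (sesq B v y) * cmod (exp (sesq B x y)) * cmod (G y) \<le> exp (M * norm v * norm y) * exp (M * norm x * norm y) * cmod (G y)"
      by (intro mult_mono mult_right_mono M(3)) auto
    also have "exp (M * norm v * norm y) * exp (M * norm x * norm y) = exp ((M * norm v + M * norm x) * norm y)"
      by (simp add: exp_add[symmetric] distrib_right)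
    finally show "cmod (sesq B v y * (exp (sesq B x y) * G y)) \<le> 1 * (exp ((M * norm v + M * norm x) * norm y) * cmod (G y))"
      by (simp only: norm_mult mult.assoc mult_1)
  qed measurable
  define a where "a = (\<chi> j. \<integral>y. sesq B (axis j 1) y * (exp (sesq B x y) * G y) \<partial>lebesgue)"
  define L where "L v = (\<Sum>j\<in>UNIV. a $ j * v $ j)" for v
  have L: "L v = (\<integral>y. sesq B v y * (exp (sesq B x y) * G y) \<partial>lebesgue)" for v
  proof -
    have "sesq B v y = (\<Sum>j\<in>UNIV. v $ j * sesq B (axis j 1) y)" for y
      by (simp add: sesq_axis(1)) (simp add: sesq_def sum_distrib_left mult_ac)
    then have "(\<integral>y. sesq B v y * (exp (sesq B x y) * G y) \<partial>lebesgue)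
        = (\<integral>y. (\<Sum>j\<in>UNIV. v $ j * (sesq B (axis j 1) y * (exp (sesq B x y) * G y))) \<partial>lebesgue)"
      by (simp add: sum_distrib_left sum_distrib_right mult_ac)
    also have "\<dots> = (\<Sum>j\<in>UNIV. \<integral>y. v $ j * (sesq B (axis j 1) y * (exp (sesq B x y) * G y)) \<partial>lebesgue)"
      by (rule Bochner_Integration.integral_sum) (intro integrable_mult_right int1)
    also have "\<dots> = L v"
      by (simp only: integral_mult_right_zero L_def a_def vec_lambda_beta mult.commute)
    finally show ?thesis by simp
  qed
  define C where "C = 2 * (\<integral>y. exp ((M * norm x + 2 * M) * norm y) * cmod (G y) \<partial>lebesgue)"
  have remainder: "cmod ((\<integral>y. exp (sesq B (x + v) y) * G y \<partial>lebesgue) - (\<integral>y. exp (sesq B x y) * G y \<partial>lebesgue) - L v) \<le> C * (norm v)\<^sup>2"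
    if v: "norm v \<le> 1" for v
  proof -
    let ?r = "\<lambda>y. exp (sesq B (x + v) y) * G y - exp (sesq B x y) * G y - sesq B v y * (exp (sesq B x y) * G y)"
    have bound: "cmod (?r y) \<le> 2 * (norm v)\<^sup>2 * (exp ((M * norm x + 2 * M) * norm y) * cmod (G y))" for y
    proof -
      define b where "b = sesq B v y"
      define t where "t = M * norm y"
      have t: "t \<ge> 0" using M(1) by (simp add: t_def)
      have b: "cmod b \<le> norm v * t" using M(2)[of v y] by (simp add: b_def t_def mult_ac)
      have "norm v * t \<le> t" using v t by (simp add: mult_left_le_one_le)
      with b have bt: "cmod b \<le> t" by simp
      have "cmod (exp b - 1 - b) \<le> exp (cmod b) * (cmod b)\<^sup>2"
        using Taylor_exp_field[of b 1] by (simp add: numeral_2_eq_2 diff_diff_eq)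
      also have "\<dots> \<le> exp t * ((norm v)\<^sup>2 * (2 * exp t))"
      proof (intro mult_mono)
        have "(cmod b)\<^sup>2 \<le> (norm v * t)\<^sup>2" using b by (intro power_mono) auto
        also have "\<dots> \<le> (norm v)\<^sup>2 * (2 * exp t)"
          using exp_lower_Taylor_quadratic[OF t] t unfolding power_mult_distrib by (intro mult_left_mono) auto
        finally show "(cmod b)\<^sup>2 \<le> (norm v)\<^sup>2 * (2 * exp t)" .
      qed (use bt in auto)
      also have "\<dots> = 2 * (norm v)\<^sup>2 * exp (2 * M * norm y)"
        by (simp add: t_def exp_add[symmetric] mult_ac)
      finally have eb: "cmod (exp b - 1 - b) \<le> 2 * (norm v)\<^sup>2 * exp (2 * M * norm y)" .
      have "?r y = exp (sesq B x y) * (exp b - 1 - b) * G y"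
        by (simp add: sesq_add exp_add b_def algebra_simps)
      then have "cmod (?r y) = cmod (exp (sesq B x y)) * cmod (exp b - 1 - b) * cmod (G y)"
        by (simp add: norm_mult)
      also have "\<dots> \<le> exp (M * norm x * norm y) * (2 * (norm v)\<^sup>2 * exp (2 * M * norm y)) * cmod (G y)"
        by (intro mult_mono mult_right_mono M(3) eb) auto
      also have "\<dots> = 2 * (norm v)\<^sup>2 * ((exp (M * norm x * norm y) * exp (2 * M * norm y)) * cmod (G y))"
        by (simp only: mult_ac)
      also have "exp (M * norm x * norm y) * exp (2 * M * norm y) = exp ((M * norm x + 2 * M) * norm y)"
        by (simp add: exp_add[symmetric] distrib_right)
      finally show ?thesis .
    qed
    have "(\<integral>y. exp (sesq B (x + v) y) * G y \<partial>lebesgue) - (\<integral>y. exp (sesq B x y) * G y \<partial>lebesgue) - L v = (\<integral>y. ?r y \<partial>lebesgue)"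
      using int0 int1 by (simp add: L)
    also have "cmod \<dots> \<le> (\<integral>y. 2 * (norm v)\<^sup>2 * (exp ((M * norm x + 2 * M) * norm y) * cmod (G y)) \<partial>lebesgue)"
      by (rule Bochner_Integration.integral_norm_bound_integral) (use int0 int1 G bound in auto)
    also have "\<dots> = C * (norm v)\<^sup>2"
      by (simp add: C_def)
    finally show ?thesis .
  qed
  have "((\<lambda>x. \<integral>y. exp (sesq B x y) * G y \<partial>lebesgue) has_derivative L) (at x)"
  proof (rule has_derivativeI_sandwich[where e = 1 and H = "\<lambda>y. C * norm (y - x)"])
    show "bounded_linear L"
      unfolding L_def
      by (rule linear_conv_bounded_linear[THEN iffD1], rule linearI)
         (auto simp: algebra_simps sum.distrib scaleR_sum_right)
    show "((\<lambda>y. C * norm (y - x)) \<longlongrightarrow> 0) (at x)"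
      by (auto intro!: tendsto_eq_intros)
    fix y assume "y \<noteq> x" "dist y x < 1"
    then have "cmod ((\<integral>z. exp (sesq B y z) * G z \<partial>lebesgue) - (\<integral>z. exp (sesq B x z) * G z \<partial>lebesgue) - L (y - x)) \<le> C * (norm (y - x))\<^sup>2"
      using remainder[of "y - x"] by (simp add: dist_norm)
    then show "norm ((\<integral>z. exp (sesq B y z) * G z \<partial>lebesgue) - (\<integral>z. exp (sesq B x z) * G z \<partial>lebesgue) - L (y - x)) / norm (y - x) \<le> C * norm (y - x)"
      using \<open>y \<noteq> x\<close> by (simp add: divide_le_eq power2_eq_square mult.assoc)
  qed simp
  then show "\<exists>a. ((\<lambda>x. \<integral>y. exp (sesq B x y) * G y \<partial>lebesgue) has_derivative (\<lambda>v. \<Sum>j\<in>UNIV. a $ j * v $ j)) (at x)"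
    unfolding L_def by blast
qed

lemma bergman_operator_holomorphic:
  fixes B :: "complex^'n^'n"
  assumes B: "hermitian_positive B" and u: "u \<in> gaussian_L2 B"
  shows "holomorphic_Cn (bergman_operator B u)"
proof -
  note [measurable] = gaussian_L2_measurable[OF u]
  have [measurable]: "(\<lambda>y. complex_of_real (exp (- Re (sesq B y y)))) \<in> borel_measurable lebesgue"
    "(\<lambda>y :: complex^'n. exp (m * norm y)) \<in> borel_measurable lebesgue" for m
    by measurable
  have "holomorphic_Cn (\<lambda>x. \<integral>y. exp (sesq B x y) * (u y * of_real (exp (- Re (sesq B y y)))) \<partial>lebesgue)"
  proof (rule holomorphic_integral_exp_sesq)
    show "integrable lebesgue (\<lambda>y. exp (m * norm y) * cmod (u y * of_real (exp (- Re (sesq B y y)))))" for m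
      by (rule gaussian_L2_integrable_exp_growth[OF B u, of _ 1 m]) (auto simp: norm_mult)
  qed measurable
  from holomorphic_Cn_mult[OF holomorphic_Cn_const[of "det B / of_real (pi ^ CARD('n))"] this] show ?thesis
    unfolding bergman_operator_def[abs_def] by (simp only: mult.assoc)
qed

text \<open>Schur's test: by the Cauchy-Schwarz inequality for the measure with density
  \<open>exp (- b(x - y, x - y) / 2)\<close>, the square of the weighted function is dominated by the convolution of an
  integrable Gaussian with an integrable function.\<close>

lemma bergman_operator_L2:
  fixes B :: "complex^'n^'n"
  assumes B: "hermitian_positive B" and u: "u \<in> gaussian_L2 B"
  shows "bergman_operator B u \<in> gaussian_L2 B"
proof -
  note [measurable] = gaussian_L2_measurable[OF u]
  have um [measurable]: "bergman_operator B u \<in> borel_measurable lebesgue"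
    by (rule measurable_lebesgue_continuous[OF holomorphic_Cn_continuous[OF bergman_operator_holomorphic[OF B u]]])
  have [measurable]: "(\<lambda>y. exp (- Re (sesq B y y))) \<in> borel_measurable lebesgue"
    "(\<lambda>y. exp (- (Re (sesq B (x - y) (x - y)) / 4))) \<in> borel_measurable lebesgue"
    "(\<lambda>y. exp (- (Re (sesq B y y) / 2))) \<in> borel_measurable lebesgue" for x
    by measurable
  define c where "c = cmod (det B / of_real (pi ^ CARD('n)))"
  define f where "f y = cmod (u y) * exp (- (Re (sesq B y y) / 2))" for y
  have [measurable]: "f \<in> borel_measurable lebesgue"
    unfolding f_def[abs_def] by measurable
  have f2: "(f y)\<^sup>2 = (cmod (u y))\<^sup>2 * exp (- Re (sesq B y y))" for y
    by (simp add: f_def power_mult_distrib power2_eq_square[of "exp _"] exp_add[symmetric])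
  let ?E = "\<lambda>w. exp (- (Re (sesq B w w) / 2))"
  \<comment> \<open>The square root of the kernel \<open>?E\<close>, which Cauchy-Schwarz puts into each of its two factors.\<close>
  let ?E4 = "\<lambda>w. exp (- (Re (sesq B w w) / 4))"
  define G where "G = (\<integral>\<^sup>+w. ennreal (?E w) \<partial>lborel)"
  have E4: "(ennreal (?E4 w))\<^sup>2 = ennreal (?E w)" for w
    by (simp add: ennreal_power power2_eq_square[of "exp _"] exp_add[symmetric])
  have EG: "(\<integral>\<^sup>+y. ennreal (?E (x - y)) \<partial>lebesgue) = G" for x
    unfolding G_def nn_integral_completion
    by (rule nn_integral_preserves_volume[OF preserves_volume_uminus, of "\<lambda>w. ennreal (?E w)"]) measurable
  have pointwise: "ennreal ((cmod (bergman_operator B u x))\<^sup>2 * exp (- Re (sesq B x x)))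
      \<le> (ennreal c)\<^sup>2 * (G * (\<integral>\<^sup>+y. ennreal (?E (x - y)) * ennreal ((f y)\<^sup>2) \<partial>lebesgue))" for x
  proof -
    let ?k = "\<lambda>y. exp (sesq B x y) * u y * of_real (exp (- Re (sesq B y y)))"
    have k: "integrable lebesgue ?k" by (rule kernel_integrable[OF B u])
    have "ennreal (cmod (bergman_operator B u x) * ?E x) = ennreal c * (ennreal (cmod (\<integral>y. ?k y \<partial>lebesgue)) * ennreal (?E x))"
    proof -
      have "cmod (bergman_operator B u x) = c * cmod (\<integral>y. ?k y \<partial>lebesgue)"
        by (simp only: bergman_operator_def c_def norm_mult)
      moreover have "c \<ge> 0" by (simp add: c_def)
      ultimately show ?thesis by (simp add: ennreal_mult' mult.assoc)
    qed
    also have "\<dots> \<le> ennreal c * ((\<integral>\<^sup>+y. ennreal (cmod (?k y)) \<partial>lebesgue) * ennreal (?E x))"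
      by (intro mult_left_mono mult_right_mono integral_norm_bound_ennreal k) auto
    also have "(\<integral>\<^sup>+y. ennreal (cmod (?k y)) \<partial>lebesgue) * ennreal (?E x) = (\<integral>\<^sup>+y. ennreal (cmod (?k y)) * ennreal (?E x) \<partial>lebesgue)"
      using borel_measurable_integrable[OF k] by (intro nn_integral_multc[symmetric]) measurable
    also have "\<dots> = (\<integral>\<^sup>+y. ennreal (?E4 (x - y)) * (ennreal (?E4 (x - y)) * ennreal (f y)) \<partial>lebesgue)"
    proof (intro nn_integral_cong)
      fix y
      have "ennreal (cmod (?k y)) * ennreal (?E x) = ennreal (?E (x - y) * f y)"
        by (simp only: ennreal_mult''[symmetric] norm_ge_zero exp_ge_zero kernel_norm[OF B] f_def)
      also have "\<dots> = (ennreal (?E4 (x - y)))\<^sup>2 * ennreal (f y)"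
        by (simp add: E4 ennreal_mult')
      finally show "ennreal (cmod (?k y)) * ennreal (?E x) = ennreal (?E4 (x - y)) * (ennreal (?E4 (x - y)) * ennreal (f y))"
        by (simp add: power2_eq_square mult_ac)
    qed
    finally have le: "ennreal (cmod (bergman_operator B u x) * ?E x)
        \<le> ennreal c * (\<integral>\<^sup>+y. ennreal (?E4 (x - y)) * (ennreal (?E4 (x - y)) * ennreal (f y)) \<partial>lebesgue)" .
    have "ennreal ((cmod (bergman_operator B u x))\<^sup>2 * exp (- Re (sesq B x x))) = (ennreal (cmod (bergman_operator B u x) * ?E x))\<^sup>2"
      by (simp add: ennreal_power power_mult_distrib power2_eq_square[of "exp _"] exp_add[symmetric])
    also have "\<dots> \<le> (ennreal c * (\<integral>\<^sup>+y. ennreal (?E4 (x - y)) * (ennreal (?E4 (x - y)) * ennreal (f y)) \<partial>lebesgue))\<^sup>2"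
      by (intro power_mono le) auto
    also have "\<dots> \<le> (ennreal c)\<^sup>2 * ((\<integral>\<^sup>+y. (ennreal (?E4 (x - y)))\<^sup>2 \<partial>lebesgue) * (\<integral>\<^sup>+y. (ennreal (?E4 (x - y)) * ennreal (f y))\<^sup>2 \<partial>lebesgue))"
      unfolding power_mult_distrib[of "ennreal c"]
      by (intro mult_left_mono Cauchy_Schwarz_nn_integral) auto
    also have "\<dots> = (ennreal c)\<^sup>2 * (G * (\<integral>\<^sup>+y. ennreal (?E (x - y)) * ennreal ((f y)\<^sup>2) \<partial>lebesgue))"
      unfolding power_mult_distrib E4 EG by (simp add: ennreal_power f_def)
    finally show ?thesis .
  qed
  have "(\<integral>\<^sup>+x. ennreal ((cmod (bergman_operator B u x))\<^sup>2 * exp (- Re (sesq B x x))) \<partial>lebesgue)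
      \<le> (\<integral>\<^sup>+x. (ennreal c)\<^sup>2 * (G * (\<integral>\<^sup>+y. ennreal (?E (x - y)) * ennreal ((f y)\<^sup>2) \<partial>lebesgue)) \<partial>lebesgue)"
    by (intro nn_integral_mono pointwise)
  also have "\<dots> = (ennreal c)\<^sup>2 * (G * (\<integral>\<^sup>+x. (\<integral>\<^sup>+y. ennreal (?E (x - y)) * ennreal ((f y)\<^sup>2) \<partial>lebesgue) \<partial>lebesgue))"
  proof -
    have [measurable]: "(\<lambda>x. \<integral>\<^sup>+y. ennreal (?E (x - y)) * ennreal ((f y)\<^sup>2) \<partial>lebesgue) \<in> borel_measurable lebesgue"
    proof (rule sigma_finite_measure.borel_measurable_nn_integral[OF sigma_finite_lebesgue])
      have [measurable]: "(\<lambda>p :: (complex^'n) \<times> (complex^'n). ?E (fst p - snd p)) \<in> borel_measurable (lebesgue \<Otimes>\<^sub>M lebesgue)"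
        by measurable
      show "(\<lambda>(x, y). ennreal (?E (x - y)) * ennreal ((f y)\<^sup>2)) \<in> borel_measurable (lebesgue \<Otimes>\<^sub>M lebesgue)"
        unfolding case_prod_beta by measurable
    qed
    show ?thesis
      by (simp add: nn_integral_cmult)
  qed
  also have "\<dots> = (ennreal c)\<^sup>2 * (G * (G * (\<integral>\<^sup>+y. ennreal ((f y)\<^sup>2) \<partial>lebesgue)))"
    unfolding G_def by (subst nn_integral_gaussian_kernel) auto
  also have "\<dots> < \<infinity>"
  proof -
    have "(\<integral>\<^sup>+y. ennreal ((f y)\<^sup>2) \<partial>lebesgue) < \<infinity>"
      using u unfolding f2 gaussian_L2_def by (auto simp: integrable_iff_bounded)
    moreover have "G < \<infinity>" unfolding G_def by (rule gaussian_kernel_finite[OF B])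
    moreover have "(ennreal c)\<^sup>2 < \<infinity>" by (simp add: power_less_top_ennreal)
    ultimately show ?thesis
      by (auto simp: ennreal_mult_less_top)
  qed
  finally have "(\<integral>\<^sup>+x. ennreal ((cmod (bergman_operator B u x))\<^sup>2 * exp (- Re (sesq B x x))) \<partial>lebesgue) < \<infinity>" .
  then have "integrable lebesgue (\<lambda>x. (cmod (bergman_operator B u x))\<^sup>2 * exp (- Re (sesq B x x)))"
    by (intro integrableI_bounded) auto
  then show ?thesis
    using um by (simp add: gaussian_L2_def)
qed

text \<open>The kernel is Hermitian and its constant is real, so the claim is Fubini's theorem; absolute
  integrability follows from \<open>f(y) g(x) \<le> f(y)\<^sup>2 + g(x)\<^sup>2\<close> for the weighted moduli \<open>f\<close> of \<open>u\<close> and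
  \<open>g\<close> of \<open>v\<close>, and from the Gaussian decay of the kernel in \<open>x - y\<close>.\<close>

lemma bergman_operator_self_adjoint:
  fixes B :: "complex^'n^'n"
  assumes B: "hermitian_positive B" and u: "u \<in> gaussian_L2 B" and v: "v \<in> gaussian_L2 B"
  shows "(\<integral>x. bergman_operator B u x * cnj (v x) * of_real (exp (- Re (sesq B x x))) \<partial>lebesgue)
    = (\<integral>y. u y * cnj (bergman_operator B v y) * of_real (exp (- Re (sesq B y y))) \<partial>lebesgue)"
proof -
  interpret pair_sigma_finite "lebesgue :: (complex^'n) measure" "lebesgue :: (complex^'n) measure"
    by (intro pair_sigma_finite.intro sigma_finite_lebesgue)
  note [measurable] = gaussian_L2_measurable[OF u] gaussian_L2_measurable[OF v]
  let ?w = "\<lambda>x. complex_of_real (exp (- Re (sesq B x x)))"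
  let ?E = "\<lambda>w. exp (- (Re (sesq B w w) / 2))"
  define F where "F x y = exp (sesq B x y) * u y * ?w y * (cnj (v x) * ?w x)" for x y
  define f where "f y = cmod (u y) * ?E y" for y
  define g where "g y = cmod (v y) * ?E y" for y
  have [measurable]: "?E \<in> borel_measurable lebesgue" "?w \<in> borel_measurable lebesgue"
    by measurable
  have [measurable]: "f \<in> borel_measurable lebesgue" "g \<in> borel_measurable lebesgue"
    unfolding f_def[abs_def] g_def[abs_def] by measurable
  have sq: "(f y)\<^sup>2 = (cmod (u y))\<^sup>2 * exp (- Re (sesq B y y))" "(g y)\<^sup>2 = (cmod (v y))\<^sup>2 * exp (- Re (sesq B y y))" for y
    by (simp_all add: f_def g_def power_mult_distrib power2_eq_square[of "exp _"] exp_add[symmetric])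
  have fin: "(\<integral>\<^sup>+y. ennreal ((f y)\<^sup>2) \<partial>lebesgue) < \<infinity>" "(\<integral>\<^sup>+y. ennreal ((g y)\<^sup>2) \<partial>lebesgue) < \<infinity>"
    using u v unfolding sq gaussian_L2_def by (auto simp: integrable_iff_bounded)
  have pm [measurable]: "(\<lambda>p :: (complex^'n) \<times> (complex^'n). ?E (fst p - snd p)) \<in> borel_measurable (lebesgue \<Otimes>\<^sub>M lebesgue)"
    "(\<lambda>p :: (complex^'n) \<times> (complex^'n). ?E (snd p - fst p)) \<in> borel_measurable (lebesgue \<Otimes>\<^sub>M lebesgue)"
    "(\<lambda>p. exp (sesq B (fst p) (snd p))) \<in> borel_measurable (lebesgue \<Otimes>\<^sub>M lebesgue)"
    by measurable
  have sym: "?E (x - y) = ?E (y - x)" for x y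
  proof -
    have "sesq B (x - y) (x - y) = sesq B (y - x) (y - x)"
      by (simp add: sesq_diff)
    then show ?thesis by simp
  qed
  have [measurable]: "(\<lambda>(x, y). F x y) \<in> borel_measurable (lebesgue \<Otimes>\<^sub>M lebesgue)"
  proof -
    have w: "?w \<in> borel_measurable lebesgue" by measurable
    have "cnj \<in> borel_measurable borel"
      by (intro borel_measurable_continuous_onI continuous_intros)
    then have v: "(\<lambda>x. cnj (v x) * ?w x) \<in> borel_measurable lebesgue"
      by (intro borel_measurable_times w measurable_compose[OF gaussian_L2_measurable[OF v]])
    show ?thesis
      unfolding F_def case_prod_beta
      by (intro borel_measurable_times measurable_compose[OF measurable_snd gaussian_L2_measurable[OF u]]
          measurable_compose[OF measurable_snd w] measurable_compose[OF measurable_fst v]) measurable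
  qed
  have norm_F: "cmod (F x y) = ?E (x - y) * f y * g x" for x y
  proof -
    have "cmod (F x y) = (cmod (exp (sesq B x y) * u y * ?w y) * ?E x) * (cmod (v x) * ?E x)"
      by (simp add: F_def norm_mult mult_ac exp_add[symmetric])
    also have "\<dots> = (?E (x - y) * f y) * g x"
      by (simp only: kernel_norm[OF B] f_def g_def)
    finally show ?thesis .
  qed
  have "(\<integral>\<^sup>+p. ennreal (norm (case p of (x, y) \<Rightarrow> F x y)) \<partial>(lebesgue \<Otimes>\<^sub>M lebesgue))
      = (\<integral>\<^sup>+x. (\<integral>\<^sup>+y. ennreal (cmod (F x y)) \<partial>lebesgue) \<partial>lebesgue)"
    by (subst sigma_finite_measure.nn_integral_fst[OF sigma_finite_lebesgue, symmetric]) simp_all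
  also have "\<dots> \<le> (\<integral>\<^sup>+x. (\<integral>\<^sup>+y. ennreal (?E (x - y)) * ennreal ((f y)\<^sup>2) + ennreal (?E (y - x)) * ennreal ((g x)\<^sup>2) \<partial>lebesgue) \<partial>lebesgue)"
  proof (intro nn_integral_mono)
    fix x y
    have "0 \<le> f y * g x" by (simp add: f_def g_def)
    then have "f y * g x \<le> (f y)\<^sup>2 + (g x)\<^sup>2"
      using sum_squares_bound[of "f y" "g x"] by linarith
    then have "?E (x - y) * (f y * g x) \<le> ?E (x - y) * ((f y)\<^sup>2 + (g x)\<^sup>2)"
      by (intro mult_left_mono) auto
    then have "ennreal (cmod (F x y)) \<le> ennreal (?E (x - y) * (f y)\<^sup>2 + ?E (x - y) * (g x)\<^sup>2)"
      unfolding norm_F by (intro ennreal_leI) (simp add: algebra_simps)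
    then show "ennreal (cmod (F x y)) \<le> ennreal (?E (x - y)) * ennreal ((f y)\<^sup>2) + ennreal (?E (y - x)) * ennreal ((g x)\<^sup>2)"
      by (simp only: sym[of y x], subst (asm) ennreal_plus) (simp_all add: ennreal_mult')
  qed
  also have "\<dots> = (\<integral>\<^sup>+x. (\<integral>\<^sup>+y. ennreal (?E (x - y)) * ennreal ((f y)\<^sup>2) \<partial>lebesgue) \<partial>lebesgue)
      + (\<integral>\<^sup>+x. (\<integral>\<^sup>+y. ennreal (?E (y - x)) * ennreal ((g x)\<^sup>2) \<partial>lebesgue) \<partial>lebesgue)"
  proof -
    have f2: "(\<lambda>y. ennreal ((f y)\<^sup>2)) \<in> borel_measurable lebesgue" by measurable
    have g2: "(\<lambda>y. ennreal ((g y)\<^sup>2)) \<in> borel_measurable lebesgue" by measurable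
    have m: "(\<lambda>(x, y). ennreal (?E (x - y)) * ennreal ((f y)\<^sup>2)) \<in> borel_measurable (lebesgue \<Otimes>\<^sub>M lebesgue)"
      "(\<lambda>(x, y). ennreal (?E (y - x)) * ennreal ((g x)\<^sup>2)) \<in> borel_measurable (lebesgue \<Otimes>\<^sub>M lebesgue)"
      unfolding case_prod_beta
      by (intro borel_measurable_times_ennreal measurable_compose[OF pm(1) measurable_ennreal]
          measurable_compose[OF pm(2) measurable_ennreal] measurable_compose[OF measurable_snd f2]
          measurable_compose[OF measurable_fst g2])+
    have "(\<integral>\<^sup>+y. ennreal (?E (x - y)) * ennreal ((f y)\<^sup>2) + ennreal (?E (y - x)) * ennreal ((g x)\<^sup>2) \<partial>lebesgue)
        = (\<integral>\<^sup>+y. ennreal (?E (x - y)) * ennreal ((f y)\<^sup>2) \<partial>lebesgue) + (\<integral>\<^sup>+y. ennreal (?E (y - x)) * ennreal ((g x)\<^sup>2) \<partial>lebesgue)" for x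
      by (rule nn_integral_add) measurable
    then show ?thesis
      using sigma_finite_measure.borel_measurable_nn_integral[OF sigma_finite_lebesgue m(1)]
        sigma_finite_measure.borel_measurable_nn_integral[OF sigma_finite_lebesgue m(2)]
      by (simp add: nn_integral_add)
  qed
  also have "(\<integral>\<^sup>+x. (\<integral>\<^sup>+y. ennreal (?E (y - x)) * ennreal ((g x)\<^sup>2) \<partial>lebesgue) \<partial>lebesgue)
      = (\<integral>\<^sup>+y. (\<integral>\<^sup>+x. ennreal (?E (y - x)) * ennreal ((g x)\<^sup>2) \<partial>lebesgue) \<partial>lebesgue)"
    by (rule Fubini'[symmetric]) (unfold case_prod_beta, measurable)
  also have "(\<integral>\<^sup>+x. (\<integral>\<^sup>+y. ennreal (?E (x - y)) * ennreal ((f y)\<^sup>2) \<partial>lebesgue) \<partial>lebesgue)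
      + (\<integral>\<^sup>+y. (\<integral>\<^sup>+x. ennreal (?E (y - x)) * ennreal ((g x)\<^sup>2) \<partial>lebesgue) \<partial>lebesgue) < \<infinity>"
    using fin gaussian_kernel_finite[OF B]
    by (simp add: nn_integral_gaussian_kernel ennreal_mult_less_top)
  finally have "integrable (lebesgue \<Otimes>\<^sub>M lebesgue) (\<lambda>(x, y). F x y)"
    by (intro integrableI_bounded) auto
  then have swap: "(\<integral>y. (\<integral>x. F x y \<partial>lebesgue) \<partial>lebesgue) = (\<integral>x. (\<integral>y. F x y \<partial>lebesgue) \<partial>lebesgue)"
    by (rule Fubini_integral)
  define c where "c = det B / of_real (pi ^ CARD('n))"
  have c: "cnj c = c"
    using gaussian_integral[OF B] by (auto simp: c_def)
  have inner_y: "(\<integral>y. F x y \<partial>lebesgue) = (\<integral>y. exp (sesq B x y) * u y * ?w y \<partial>lebesgue) * (cnj (v x) * ?w x)" for x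
    unfolding F_def by (rule integral_mult_left_zero)
  have inner_x: "(\<integral>x. F x y \<partial>lebesgue) = u y * ?w y * cnj (\<integral>x. exp (sesq B y x) * v x * ?w x \<partial>lebesgue)" for y
  proof -
    have "F x y = u y * ?w y * cnj (exp (sesq B y x) * v x * ?w x)" for x
      by (simp add: F_def exp_cnj sesq_cnj[OF B, of x y])
    then show ?thesis by (simp only: integral_mult_right_zero Bochner_Integration.integral_cnj)
  qed
  have "(\<integral>x. bergman_operator B u x * cnj (v x) * ?w x \<partial>lebesgue) = (\<integral>x. c * (\<integral>y. F x y \<partial>lebesgue) \<partial>lebesgue)"
    unfolding inner_y bergman_operator_def c_def by (simp add: mult.assoc)
  also have "\<dots> = (\<integral>y. c * (\<integral>x. F x y \<partial>lebesgue) \<partial>lebesgue)"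
    by (simp only: integral_mult_right_zero swap)
  also have "\<dots> = (\<integral>y. u y * cnj (bergman_operator B v y) * ?w y \<partial>lebesgue)"
    unfolding inner_x bergman_operator_def c_def[symmetric] complex_cnj_mult c by (simp add: mult_ac)
  finally show ?thesis .
qed

lemma exp_sesq_in_gaussian_L2:
  fixes B :: "complex^'n^'n"
  assumes B: "hermitian_positive B"
  shows "(\<lambda>y. exp (sesq B y x)) \<in> gaussian_L2 B"
proof -
  obtain M where M: "\<And>x y. cmod (exp (sesq B x y)) \<le> exp (M * norm x * norm y)"
    using exp_sesq_bound[of B] by blast
  have int: "integrable lebesgue (\<lambda>y. (cmod (of_real (exp (M * norm x * norm y))))\<^sup>2 * exp (- Re (sesq B y y)))"
    using exp_norm_in_gaussian_L2[OF B, of "M * norm x"] unfolding gaussian_L2_def by blast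
  have "integrable lebesgue (\<lambda>y. (cmod (exp (sesq B y x)))\<^sup>2 * exp (- Re (sesq B y y)))"
  proof (rule Bochner_Integration.integrable_bound[OF int])
    show "AE y in lebesgue. norm ((cmod (exp (sesq B y x)))\<^sup>2 * exp (- Re (sesq B y y)))
        \<le> norm ((cmod (of_real (exp (M * norm x * norm y))))\<^sup>2 * exp (- Re (sesq B y y)))"
    proof (rule AE_I2)
      fix y
      have "cmod (exp (sesq B y x)) \<le> exp (M * norm x * norm y)"
        using M[of y x] by (simp add: mult_ac)
      then have "(cmod (exp (sesq B y x)))\<^sup>2 \<le> (exp (M * norm x * norm y))\<^sup>2"
        by (intro power_mono) auto
      then show "norm ((cmod (exp (sesq B y x)))\<^sup>2 * exp (- Re (sesq B y y)))
        \<le> norm ((cmod (of_real (exp (M * norm x * norm y))))\<^sup>2 * exp (- Re (sesq B y y)))"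
        by (simp add: abs_mult mult_right_mono del: norm_exp_eq_Re)
    qed
  qed measurable
  then show ?thesis by (simp add: gaussian_L2_def)
qed

lemma gaussian_L2_product_integrable:
  assumes u: "u \<in> gaussian_L2 B" and v: "v \<in> gaussian_L2 B"
  shows "integrable lebesgue (\<lambda>x. u x * cnj (v x) * of_real (exp (- Re (sesq B x x))))"
proof (rule gaussian_L2_integrable_product[OF u v, of _ 1])
  have "cnj \<in> borel_measurable borel"
    by (intro borel_measurable_continuous_onI continuous_intros)
  then have "(\<lambda>x. cnj (v x)) \<in> borel_measurable lebesgue"
    by (rule measurable_compose[OF gaussian_L2_measurable[OF v]])
  moreover have "(\<lambda>x. complex_of_real (exp (- Re (sesq B x x)))) \<in> borel_measurable lebesgue"
    by measurable
  ultimately show "(\<lambda>x. u x * cnj (v x) * of_real (exp (- Re (sesq B x x)))) \<in> borel_measurable lebesgue"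
    using gaussian_L2_measurable[OF u] by (intro borel_measurable_times)
qed (simp add: norm_mult)

lemma bergman_operator_orthogonal:
  assumes B: "hermitian_positive B" and u: "u \<in> gaussian_L2 B" and v: "v \<in> gaussian_L2 B" "holomorphic_Cn v"
  shows "(\<integral>x. (u x - bergman_operator B u x) * cnj (v x) * of_real (exp (- Re (sesq B x x))) \<partial>lebesgue) = 0"
proof -
  let ?w = "\<lambda>x. complex_of_real (exp (- Re (sesq B x x)))"
  have "(\<integral>x. (u x - bergman_operator B u x) * cnj (v x) * ?w x \<partial>lebesgue)
      = (\<integral>x. u x * cnj (v x) * ?w x - bergman_operator B u x * cnj (v x) * ?w x \<partial>lebesgue)"
    by (simp add: algebra_simps)
  also have "\<dots> = (\<integral>x. u x * cnj (v x) * ?w x \<partial>lebesgue) - (\<integral>x. bergman_operator B u x * cnj (v x) * ?w x \<partial>lebesgue)"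
    by (intro Bochner_Integration.integral_diff gaussian_L2_product_integrable u v bergman_operator_L2 B)
  also have "(\<integral>x. bergman_operator B u x * cnj (v x) * ?w x \<partial>lebesgue) = (\<integral>x. u x * cnj (v x) * ?w x \<partial>lebesgue)"
    using bergman_operator_self_adjoint[OF B u v(1)] reproducing_property[OF B v] by simp
  finally show ?thesis by simp
qed

text \<open>Orthogonality is tested against \<open>y \<mapsto> exp (b(y, x))\<close>: pairing with this function is, up to the constant,
  evaluation of the Bergman operator at \<open>x\<close>.\<close>

lemma bergman_operator_unique:
  assumes B: "hermitian_positive B" and u: "u \<in> gaussian_L2 B" and p: "p \<in> gaussian_L2 B" "holomorphic_Cn p"
    and orth: "\<And>v. v \<in> gaussian_L2 B \<Longrightarrow> holomorphic_Cn v \<Longrightarrow>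
      (\<integral>y. (u y - p y) * cnj (v y) * of_real (exp (- Re (sesq B y y))) \<partial>lebesgue) = 0"
  shows "p x = bergman_operator B u x"
proof -
  let ?w = "\<lambda>y. complex_of_real (exp (- Re (sesq B y y)))"
  let ?k = "\<lambda>y. exp (sesq B y x)"
  have k: "?k \<in> gaussian_L2 B" by (rule exp_sesq_in_gaussian_L2[OF B])
  have *: "f y * cnj (?k y) * ?w y = exp (sesq B x y) * f y * ?w y" for f y
    using sesq_cnj[OF B, of y x] by (simp add: exp_cnj mult_ac)
  have "0 = (\<integral>y. (u y - p y) * cnj (?k y) * ?w y \<partial>lebesgue)"
    by (rule orth[symmetric]) (intro k holomorphic_Cn_exp holomorphic_Cn_sesq)+
  also have "\<dots> = (\<integral>y. u y * cnj (?k y) * ?w y - p y * cnj (?k y) * ?w y \<partial>lebesgue)"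
    by (simp add: algebra_simps)
  also have "\<dots> = (\<integral>y. u y * cnj (?k y) * ?w y \<partial>lebesgue) - (\<integral>y. p y * cnj (?k y) * ?w y \<partial>lebesgue)"
    by (intro Bochner_Integration.integral_diff gaussian_L2_product_integrable u p k)
  finally have "bergman_operator B u x = bergman_operator B p x"
    unfolding * bergman_operator_def by simp
  then show ?thesis
    using reproducing_property[OF B p] by simp
qed

section \<open>Quadratic forms and the Levi form of the weight\<close>

definition bilin :: "complex^'n^'n \<Rightarrow> complex^'n \<Rightarrow> complex^'n \<Rightarrow> complex" where
  "bilin A x y = (\<Sum>j\<in>UNIV. \<Sum>k\<in>UNIV. A $ j $ k * x $ j * y $ k)"

lemma vec_cnj_simps [simp]:
  "vec_cnj (vec_cnj x) = x" "vec_cnj (x + y) = vec_cnj x + vec_cnj y" "vec_cnj (c *s x) = cnj c *s vec_cnj x"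
  "vec_cnj (axis i s) = axis i (cnj s)"
  by (auto simp: vec_cnj_def vec_eq_iff axis_def)

lemma sesq_eq_bilin: "sesq B x y = bilin B x (vec_cnj y)"
  by (simp add: sesq_def bilin_def vec_cnj_def)

lemma bilin_eq_sesq: "bilin B x y = sesq B x (vec_cnj y)"
  by (simp add: sesq_eq_bilin)

lemma bilin_add: "bilin A (x + x') y = bilin A x y + bilin A x' y" "bilin A x (y + y') = bilin A x y + bilin A x y'"
  by (simp_all add: bilin_eq_sesq sesq_add)

lemma bilin_scale: "bilin A (c *s x) y = c * bilin A x y" "bilin A x (c *s y) = c * bilin A x y"
  by (simp_all add: bilin_eq_sesq sesq_scale)

lemma bilin_square: "bilin A (c *s x) (c *s x) = c\<^sup>2 * bilin A x x"
  by (simp add: bilin_scale power2_eq_square mult.assoc)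

lemma bilin_axis: "bilin A (axis i s) (axis j t) = s * t * A $ i $ j"
  by (simp add: bilin_eq_sesq sesq_axis_axis)

lemma holomorphic_quadratic_form_iff:
  "holomorphic_quadratic_form q \<longleftrightarrow> (\<exists>A B C. \<forall>x y. q x y = bilin A x x + bilin B x y + bilin C y y)"
  by (simp add: holomorphic_quadratic_form_def bilin_def)

lemma deriv_quadratic: "deriv (\<lambda>t::complex. a + b * t + c * t * t) 0 = b"
proof (rule DERIV_imp_deriv)
  show "((\<lambda>t. a + b * t + c * t * t) has_field_derivative b) (at 0)"
    by (auto intro!: derivative_eq_intros)
qed

lemma hessian_xy_eq:
  assumes "\<And>x y. q x y = bilin A x x + bilin B x y + bilin C y y"
  shows "hessian_xy q = B"
proof -
  have "deriv (\<lambda>t. q (axis j s) (axis k t)) 0 = B $ j $ k * s" for j k s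
    using deriv_quadratic[of "s * s * A $ j $ j" "B $ j $ k * s" "C $ k $ k"]
    by (simp add: assms bilin_axis mult_ac)
  moreover have "deriv (\<lambda>s. B $ j $ k * s) 0 = B $ j $ k" for j k
    using deriv_quadratic[of 0 "B $ j $ k" 0] by simp
  ultimately show ?thesis
    by (simp add: hessian_xy_def vec_eq_iff)
qed

lemma hessian_yy_eq:
  assumes "\<And>x y. q x y = bilin A x x + bilin B x y + bilin C y y"
  shows "hessian_yy q $ j $ k = C $ j $ k + C $ k $ j"
proof -
  have q0: "q 0 y = bilin C y y" for y
    by (simp add: assms bilin_eq_sesq)
  have "deriv (\<lambda>t. q 0 (axis j s + axis k t)) 0 = (C $ j $ k + C $ k $ j) * s" for s
    using deriv_quadratic[of "s * s * C $ j $ j" "(C $ j $ k + C $ k $ j) * s" "C $ k $ k"]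
    by (simp add: q0 bilin_add bilin_axis algebra_simps)
  moreover have "deriv (\<lambda>s. (C $ j $ k + C $ k $ j) * s) 0 = C $ j $ k + C $ k $ j"
    using deriv_quadratic[of 0 "C $ j $ k + C $ k $ j" 0] by simp
  ultimately show ?thesis
    by (simp add: hessian_yy_def)
qed

text \<open>For real \<open>y\<close>, \<open>- Im \<phi>(x, y)\<close> is a constant, plus a real linear function of \<open>y\<close>, minus the positive definite
  form \<open>S(y) = Im \<phi>(0, y)\<close>. The constants for \<open>x = w\<close> and \<open>x = \<i>w\<close> cancel, and the linear parts are
  \<open>- Im z\<close> and \<open>- Re z\<close> for \<open>z = (\<phi>''\<^sub>x\<^sub>y)\<^sup>T w\<close>, which is nonzero. Hence small multiples of these
  vectors are test points at which the sum is positive.\<close>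

lemma sup_transform_levi_positive:
  fixes \<phi> :: "complex^'n \<Rightarrow> complex^'n \<Rightarrow> complex"
  assumes \<phi>: "holomorphic_quadratic_form \<phi>" and det: "det (hessian_xy \<phi>) \<noteq> 0"
    and pd: "positive_definite (Im_matrix (hessian_yy \<phi>))"
    and \<Phi>: "\<And>x. \<Phi> x = (SUP y :: real^'n. - Im (\<phi> x (vec_of_real y)))"
    and w: "w \<noteq> 0"
  shows "\<Phi> w + \<Phi> (\<i> *s w) > 0"
proof -
  obtain A B C where q: "\<And>x y. \<phi> x y = bilin A x x + bilin B x y + bilin C y y"
    using \<phi> unfolding holomorphic_quadratic_form_iff by blast
  define S where "S y = Im (bilin C (vec_of_real y) (vec_of_real y))" for y :: "real^'n"
  define z where "z x = (\<chi> k. \<Sum>j\<in>UNIV. B $ j $ k * x $ j)" for x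
  have S_sum: "S y = (\<Sum>j\<in>UNIV. \<Sum>k\<in>UNIV. Im (C $ j $ k) * y $ j * y $ k)" for y
    by (simp add: S_def bilin_def vec_of_real_def)
  have S_cont: "continuous_on UNIV S"
    unfolding S_sum[abs_def] by (intro continuous_intros)
  have S_scale: "S (t *\<^sub>R y) = t\<^sup>2 * S y" for t y
    by (simp add: S_sum sum_distrib_left power2_eq_square mult_ac)
  have S_pos: "S y > 0" if "y \<noteq> 0" for y
  proof -
    have "y \<bullet> (Im_matrix (hessian_yy \<phi>) *v y) = (\<Sum>j\<in>UNIV. \<Sum>k\<in>UNIV. Im (C $ j $ k) * y $ j * y $ k + Im (C $ k $ j) * y $ j * y $ k)"
      unfolding inner_vec_def matrix_vector_mult_def Im_matrix_def
      by (simp add: hessian_yy_eq[OF q] sum_distrib_left algebra_simps)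
    also have "\<dots> = S y + (\<Sum>j\<in>UNIV. \<Sum>k\<in>UNIV. Im (C $ k $ j) * y $ j * y $ k)"
      by (simp add: S_sum sum.distrib)
    also have "(\<Sum>j\<in>UNIV. \<Sum>k\<in>UNIV. Im (C $ k $ j) * y $ j * y $ k) = S y"
      unfolding S_sum by (subst sum.swap) (simp add: mult_ac)
    finally have "y \<bullet> (Im_matrix (hessian_yy \<phi>) *v y) = 2 * S y" by simp
    moreover have "y \<bullet> (Im_matrix (hessian_yy \<phi>) *v y) > 0"
      using pd that unfolding positive_definite_def by blast
    ultimately show ?thesis by linarith
  qed
  obtain \<kappa> where \<kappa>: "\<kappa> > 0" "\<And>y. \<kappa> * (norm y)\<^sup>2 \<le> S y"
    using positive_quadratic_lower_bound[OF S_cont S_scale S_pos] by blast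
  have expand: "- Im (\<phi> x (vec_of_real y)) = - Im (bilin A x x) - (\<chi> k. Im (z x $ k)) \<bullet> y - S y" for x y
  proof -
    have "bilin B x (vec_of_real y) = (\<Sum>k\<in>UNIV. z x $ k * of_real (y $ k))"
      unfolding bilin_def by (subst sum.swap) (simp add: z_def vec_of_real_def sum_distrib_right)
    then show ?thesis
      by (simp add: q S_def inner_vec_def)
  qed
  have lower: "- Im (bilin A x x) - (\<chi> k. Im (z x $ k)) \<bullet> y - S y \<le> \<Phi> x" for x y
  proof -
    have "bdd_above (range (\<lambda>y. - Im (\<phi> x (vec_of_real y))))"
    proof (rule bdd_aboveI2)
      fix y
      let ?a = "(\<chi> k. Im (z x $ k)) :: real^'n"
      have "- (?a \<bullet> y) \<le> norm ?a * norm y"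
        using Cauchy_Schwarz_ineq2[of ?a y] by linarith
      moreover have "norm ?a * norm y \<le> (norm ?a)\<^sup>2 / (4 * \<kappa>) + \<kappa> * (norm y)\<^sup>2"
      proof -
        have "0 \<le> (norm ?a - 2 * \<kappa> * norm y)\<^sup>2 / (4 * \<kappa>)" using \<kappa> by simp
        also have "\<dots> = (norm ?a)\<^sup>2 / (4 * \<kappa>) + \<kappa> * (norm y)\<^sup>2 - norm ?a * norm y"
          using \<kappa>(1) by (simp add: field_simps power2_eq_square)
        finally show ?thesis by simp
      qed
      ultimately show "- Im (\<phi> x (vec_of_real y)) \<le> - Im (bilin A x x) + (norm ?a)\<^sup>2 / (4 * \<kappa>)"
        unfolding expand using \<kappa>(2)[of y] by linarith
    qed
    then have "- Im (\<phi> x (vec_of_real y)) \<le> \<Phi> x"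
      unfolding \<Phi> by (rule cSUP_upper[OF UNIV_I])
    then show ?thesis by (simp add: expand)
  qed
  define a b where "a = (\<chi> k. Im (z w $ k))" and "b = (\<chi> k. Re (z w $ k))"
  have zi: "(\<chi> k. Im (z (\<i> *s w) $ k)) = b"
  proof -
    have "z (\<i> *s w) $ k = \<i> * z w $ k" for k
      by (simp add: z_def sum_distrib_left mult_ac)
    then show ?thesis by (simp add: b_def)
  qed
  have Ai: "Im (bilin A (\<i> *s w) (\<i> *s w)) = - Im (bilin A w w)"
    by (simp add: bilin_scale flip: mult.assoc)
  have zw: "z w \<noteq> 0"
  proof
    assume "z w = 0"
    moreover have "z w = transpose B *v w"
      by (simp add: z_def matrix_vector_mult_def transpose_def)
    moreover have "invertible (transpose B)"
      using det hessian_xy_eq[OF q] by (simp add: invertible_det_nz)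
    ultimately show False
      using w by (metis inj_matrix_vector_mult injD matrix_vector_mult_0_right)
  qed
  define N where "N = (norm a)\<^sup>2 + (norm b)\<^sup>2"
  define T where "T = S a + S b"
  have "N > 0"
  proof -
    have "a \<noteq> 0 \<or> b \<noteq> 0"
      using zw by (auto simp: a_def b_def vec_eq_iff complex_eq_iff)
    then show ?thesis
      unfolding N_def by (auto intro: add_pos_nonneg add_nonneg_pos)
  qed
  have "T \<ge> 0"
  proof -
    have "S y \<ge> 0" for y using S_pos[of y] S_scale[of 0 y] by (cases "y = 0") auto
    then show ?thesis by (simp add: T_def)
  qed
  \<comment> \<open>Small enough for \<open>\<epsilon> N\<close> to exceed \<open>\<epsilon>\<^sup>2 T\<close>, also when \<open>T\<close> is large.\<close>
  define \<epsilon> where "\<epsilon> = N / (T + 1)"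
  have N_eq: "N = \<epsilon> * (T + 1)"
    using \<open>T \<ge> 0\<close> by (simp add: \<epsilon>_def)
  have "0 < \<epsilon>\<^sup>2"
    using \<open>N > 0\<close> \<open>T \<ge> 0\<close> by (simp add: \<epsilon>_def)
  also have "\<dots> = \<epsilon> * N - \<epsilon>\<^sup>2 * T"
    by (simp add: N_eq algebra_simps power2_eq_square)
  also have "\<dots> = (- Im (bilin A w w) - a \<bullet> ((- \<epsilon>) *\<^sub>R a) - S ((- \<epsilon>) *\<^sub>R a))
      + (Im (bilin A w w) - b \<bullet> ((- \<epsilon>) *\<^sub>R b) - S ((- \<epsilon>) *\<^sub>R b))"
    unfolding S_scale by (simp add: N_def T_def power2_norm_eq_inner algebra_simps)
  also have "\<dots> \<le> \<Phi> w + \<Phi> (\<i> *s w)"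
    using lower[of w "(- \<epsilon>) *\<^sub>R a"] lower[of "\<i> *s w" "(- \<epsilon>) *\<^sub>R b"]
    unfolding zi Ai a_def[symmetric] by linarith
  finally show ?thesis .
qed

text \<open>Replacing \<open>w\<close> by \<open>\<i>w\<close> changes the sign of the holomorphic and of the antiholomorphic part and keeps the
  mixed part, which is therefore real on the diagonal, hence Hermitian. Replacing \<open>w\<close> by \<open>(1 + \<i>) w\<close> multiplies
  these two parts by \<open>2\<i>\<close> and \<open>-2\<i>\<close>, which gives the real part of the conjugation symmetry
  between them; the imaginary part comes from \<open>w\<close> itself.\<close>

lemma polarized_weight:
  assumes q: "\<And>x y. \<psi> x y = bilin A x x + bilin B x y + bilin C y y"
    and real: "\<And>x. \<psi> x (vec_cnj x) = complex_of_real (\<Phi> x)"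
    and pos: "\<And>w. w \<noteq> 0 \<Longrightarrow> \<Phi> w + \<Phi> (\<i> *s w) > 0"
  shows "hermitian_positive B"
    and "\<psi> x (vec_cnj y) = bilin A x x + sesq B x y + cnj (bilin A y y)"
    and "\<Phi> y = 2 * Re (bilin A y y) + Re (sesq B y y)"
proof -
  have eq: "bilin A w w + sesq B w w + bilin C (vec_cnj w) (vec_cnj w) = of_real (\<Phi> w)" for w
    using real[of w] by (simp add: q sesq_eq_bilin)
  have sesq: "sesq B w w = of_real ((\<Phi> w + \<Phi> (\<i> *s w)) / 2)" for w
  proof -
    have A: "bilin A (\<i> *s w) (\<i> *s w) = - bilin A w w"
      using bilin_square[of A \<i> w] by simp
    have C: "bilin C (vec_cnj (\<i> *s w)) (vec_cnj (\<i> *s w)) = - bilin C (vec_cnj w) (vec_cnj w)"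
      using bilin_square[of C "- \<i>" "vec_cnj w"] by simp
    have S: "sesq B (\<i> *s w) (\<i> *s w) = sesq B w w"
      by (simp add: sesq_scale)
    have "of_real (\<Phi> w) + of_real (\<Phi> (\<i> *s w)) = 2 * sesq B w w"
      unfolding eq[symmetric] A C S by simp
    then show ?thesis by (simp add: field_simps)
  qed
  have im: "Im (sesq B w w) = 0" for w by (simp add: sesq)
  have herm: "B $ k $ j = cnj (B $ j $ k)" for j k
  proof -
    have diag: "Im (B $ i $ i) = 0" for i
      using im[of "axis i 1"] by (simp add: sesq_axis_axis)
    \<comment> \<open>Polarisation: \<open>c = 1\<close> compares the imaginary parts, \<open>c = \<i>\<close> the real parts.\<close>
    have "Im (sesq B (axis j 1 + axis k c) (axis j 1 + axis k c)) = Im (cnj c * B $ j $ k + c * B $ k $ j)"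
      if "c * cnj c = 1" for c
      using diag[of j] diag[of k] that by (simp add: sesq_add sesq_axis_axis)
    from this[of 1] this[of \<i>] show ?thesis
      by (simp add: im complex_eq_iff)
  qed
  show "hermitian_positive B"
    unfolding hermitian_positive_def
  proof (intro conjI allI impI)
    show "B $ k $ j = cnj (B $ j $ k)" for j k by (rule herm)
    show "Re (sesq B w w) > 0" if "w \<noteq> 0" for w
      using pos[OF that] by (simp add: sesq)
  qed
  have conj: "bilin C (vec_cnj w) (vec_cnj w) = cnj (bilin A w w)" for w
  proof -
    have s: "Im (bilin A w w + bilin C (vec_cnj w) (vec_cnj w)) = 0" for w
      using eq[of w] im[of w] by (simp add: complex_eq_iff)
    have "(1 + \<i>)\<^sup>2 = 2 * \<i>" "(1 - \<i>)\<^sup>2 = - 2 * \<i>"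
      by (simp_all add: power2_eq_square complex_eq_iff)
    then have "Im (2 * \<i> * bilin A w w - 2 * \<i> * bilin C (vec_cnj w) (vec_cnj w)) = 0"
      using s[of "(1 + \<i>) *s w"] bilin_square[of A "1 + \<i>" w] bilin_square[of C "1 - \<i>" "vec_cnj w"]
      by simp
    with s[of w] show ?thesis by (simp add: complex_eq_iff)
  qed
  show "\<psi> x (vec_cnj y) = bilin A x x + sesq B x y + cnj (bilin A y y)"
    by (simp add: q sesq_eq_bilin conj)
  show "\<Phi> y = 2 * Re (bilin A y y) + Re (sesq B y y)"
    using arg_cong[OF eq[of y], of Re] by (simp add: conj)
qed

section \<open>The projection formula for a quadratic weight\<close>

theorem proposition1p3p4:
  fixes \<phi> \<psi> :: "complex ^ 'n \<Rightarrow> complex ^ 'n \<Rightarrow> complex"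
    and \<Phi> :: "complex ^ 'n \<Rightarrow> real"
    and h :: real
  assumes "0 < h" and "h \<le> 1"
    and "holomorphic_quadratic_form \<phi>"
    and "det (hessian_xy \<phi>) \<noteq> 0"
    and "positive_definite (Im_matrix (hessian_yy \<phi>))"
    and "\<And>x. \<Phi> x = (SUP y :: real ^ 'n. - Im (\<phi> x (vec_of_real y)))"
    and "holomorphic_quadratic_form \<psi>"
    and "\<And>x. \<psi> x (vec_cnj x) = complex_of_real (\<Phi> x)"
  shows "(\<exists>P. orthogonal_projection (weighted_lebesgue \<Phi> h) (holomorphic_L2 \<Phi> h) P) \<and>
    (\<forall>P. orthogonal_projection (weighted_lebesgue \<Phi> h) (holomorphic_L2 \<Phi> h) P \<longrightarrow>
      (\<forall>u \<in> L2_space (weighted_lebesgue \<Phi> h). \<forall>x.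
        integrable lebesgue
          (\<lambda>y. exp (2 * \<psi> x (vec_cnj y) / of_real h) * u y * of_real (exp (- 2 * \<Phi> y / h))) \<and>
        P u x = 2 ^ CARD('n) * det (hessian_xy \<psi>) / of_real ((pi * h) ^ CARD('n)) *
          (LINT y|lebesgue.
             exp (2 * \<psi> x (vec_cnj y) / of_real h) * u y * of_real (exp (- 2 * \<Phi> y / h)))))"
proof -
  note h = \<open>0 < h\<close>
  obtain A B C where q: "\<And>x y. \<psi> x y = bilin A x x + bilin B x y + bilin C y y"
    using assms(7) unfolding holomorphic_quadratic_form_iff by blast
  note levi = sup_transform_levi_positive[OF assms(3-6)]
  note pw = polarized_weight[OF q assms(8) levi]
  \<comment> \<open>\<open>K\<close> is the Gaussian weight that remains after conjugation by \<open>exp \<beta>\<close>.\<close>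
  define K where "K = (\<chi> j k. of_real (2 / h) * B $ j $ k)"
  define \<beta> where "\<beta> x = of_real (2 / h) * bilin A x x" for x
  have sesq_K: "sesq K x y = of_real (2 / h) * sesq B x y" for x y
    by (simp add: K_def sesq_def sum_distrib_left mult_ac)
  have K: "hermitian_positive K"
    unfolding hermitian_positive_def
  proof (intro conjI allI impI)
    show "K $ k $ j = cnj (K $ j $ k)" for j k
      using hermitian_positiveD(1)[OF pw(1), of k j] by (simp add: K_def)
    show "Re (sesq K w w) > 0" if "w \<noteq> 0" for w
      using hermitian_positiveD(2)[OF pw(1) that] h unfolding sesq_K by simp
  qed
  have det_K: "det K = of_real ((2 / h) ^ CARD('n)) * det (hessian_xy \<psi>)"
  proof -
    have "K = (\<chi> i. of_real (2 / h) *s B $ i)"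
      by (simp add: K_def vec_eq_iff)
    then show ?thesis
      using det_rows_mul[of "\<lambda>_. of_real (2 / h)" "\<lambda>i. B $ i"]
      by (simp add: hessian_xy_eq[OF q])
  qed
  have \<beta>_hol: "holomorphic_Cn (\<lambda>x. c * \<beta> x)" for c
    unfolding \<beta>_def bilin_def
    by (intro holomorphic_Cn_sum holomorphic_Cn_mult holomorphic_Cn_const holomorphic_Cn_coordinate)
  have e_hol: "holomorphic_Cn (\<lambda>x. exp (\<beta> x))" "holomorphic_Cn (\<lambda>x. exp (- \<beta> x))"
    using holomorphic_Cn_exp[OF \<beta>_hol[of 1]] holomorphic_Cn_exp[OF \<beta>_hol[of "-1"]] by simp_all
  have e_meas: "(\<lambda>x. exp (\<beta> x)) \<in> borel_measurable lebesgue" "(\<lambda>x. exp (- \<beta> x)) \<in> borel_measurable lebesgue"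
    using e_hol by (auto intro: measurable_lebesgue_continuous holomorphic_Cn_continuous)
  have weight: "exp (- 2 * \<Phi> y / h) = (cmod (exp (- \<beta> y)))\<^sup>2 * exp (- Re (sesq K y y))" for y
    using h by (simp add: pw(3) \<beta>_def sesq_K power2_eq_square field_simps flip: exp_add)
  have weight_meas: "(\<lambda>y. exp (- 2 * \<Phi> y / h)) \<in> borel_measurable lebesgue"
  proof -
    have "(\<lambda>y. exp (- Re (sesq K y y))) \<in> borel_measurable lebesgue" by measurable
    then show ?thesis
      unfolding weight
      by (intro borel_measurable_times borel_measurable_power measurable_compose[OF e_meas(2) borel_measurable_norm])
  qed
  let ?M = "weighted_lebesgue \<Phi> h"
  let ?H = "holomorphic_L2 \<Phi> h"
  \<comment> \<open>\<open>U\<close> is the unitary map onto the Gaussian model space, \<open>V\<close> its inverse.\<close>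
  define U where "U u x = exp (- \<beta> x) * u x" for u x
  define V where "V u x = exp (\<beta> x) * u x" for u x
  have UV: "U (V u) = u" "V (U u) = u" for u
    by (auto simp: U_def V_def fun_eq_iff exp_minus)
  have U_meas: "U u \<in> borel_measurable lebesgue \<longleftrightarrow> u \<in> borel_measurable lebesgue" for u
  proof
    assume "U u \<in> borel_measurable lebesgue"
    then have "V (U u) \<in> borel_measurable lebesgue"
      unfolding V_def[abs_def] by (intro borel_measurable_times e_meas)
    then show "u \<in> borel_measurable lebesgue" by (simp add: UV)
  qed (unfold U_def[abs_def], intro borel_measurable_times e_meas)
  have meas_M: "u \<in> borel_measurable ?M \<longleftrightarrow> u \<in> borel_measurable lebesgue" for u :: "complex^'n \<Rightarrow> complex"
    by (simp add: weighted_lebesgue_def)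
  have L2_iff: "u \<in> L2_space ?M \<longleftrightarrow> U u \<in> gaussian_L2 K" for u
  proof (cases "u \<in> borel_measurable lebesgue")
    case True
    have "integrable ?M (\<lambda>x. (cmod (u x))\<^sup>2) \<longleftrightarrow> integrable lebesgue (\<lambda>x. exp (- 2 * \<Phi> x / h) *\<^sub>R (cmod (u x))\<^sup>2)"
      unfolding weighted_lebesgue_def using True weight_meas
      by (intro integrable_density) auto
    also have "(\<lambda>x. exp (- 2 * \<Phi> x / h) *\<^sub>R (cmod (u x))\<^sup>2) = (\<lambda>x. (cmod (U u x))\<^sup>2 * exp (- Re (sesq K x x)))"
      unfolding weight by (simp add: fun_eq_iff U_def norm_mult power_mult_distrib mult_ac)
    finally show ?thesis
      using True U_meas[of u] by (simp add: L2_space_def gaussian_L2_def meas_M)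
  qed (use U_meas[of u] in \<open>simp add: L2_space_def gaussian_L2_def meas_M\<close>)
  have hol_U: "holomorphic_Cn (U u) \<longleftrightarrow> holomorphic_Cn u" for u
  proof
    assume "holomorphic_Cn (U u)"
    then have "holomorphic_Cn (V (U u))"
      unfolding V_def[abs_def] by (intro holomorphic_Cn_mult e_hol)
    then show "holomorphic_Cn u" by (simp add: UV)
  qed (unfold U_def[abs_def], intro holomorphic_Cn_mult e_hol)
  have H_iff: "u \<in> ?H \<longleftrightarrow> U u \<in> gaussian_L2 K \<and> holomorphic_Cn (U u)" for u
    by (simp add: holomorphic_L2_def L2_iff hol_U)
  have inner: "L2_inner ?M (\<lambda>x. u x - p x) v =
      (\<integral>x. (U u x - U p x) * cnj (U v x) * of_real (exp (- Re (sesq K x x))) \<partial>lebesgue)"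
    if "u \<in> L2_space ?M" "p \<in> ?H" "v \<in> ?H" for u p v
  proof -
    have "u \<in> borel_measurable lebesgue" "p \<in> borel_measurable lebesgue" "v \<in> borel_measurable lebesgue"
      using that by (auto simp: L2_space_def holomorphic_L2_def meas_M)
    moreover have "cnj \<in> borel_measurable borel"
      by (intro borel_measurable_continuous_onI continuous_intros)
    ultimately have m: "(\<lambda>x. (u x - p x) * cnj (v x)) \<in> borel_measurable lebesgue"
      by (intro borel_measurable_times borel_measurable_diff measurable_compose[of v lebesgue borel cnj])
    have L: "L2_inner ?M (\<lambda>x. u x - p x) v = (\<integral>x. exp (- 2 * \<Phi> x / h) *\<^sub>R ((u x - p x) * cnj (v x)) \<partial>lebesgue)"
      unfolding L2_inner_def weighted_lebesgue_def using m weight_meas by (intro integral_density) auto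
    have pt: "exp (- 2 * \<Phi> x / h) *\<^sub>R ((u x - p x) * cnj (v x)) = (U u x - U p x) * cnj (U v x) * of_real (exp (- Re (sesq K x x)))" for x
    proof -
      have "complex_of_real (exp (- 2 * \<Phi> x / h)) = exp (- \<beta> x) * cnj (exp (- \<beta> x)) * of_real (exp (- Re (sesq K x x)))"
        unfolding weight of_real_mult complex_norm_square ..
      then show ?thesis
        by (simp add: scaleR_conv_of_real U_def algebra_simps)
    qed
    show ?thesis
      using L unfolding pt .
  qed
  have kernel: "exp (2 * \<psi> x (vec_cnj y) / of_real h) * u y * of_real (exp (- 2 * \<Phi> y / h))
      = exp (\<beta> x) * (exp (sesq K x y) * U u y * of_real (exp (- Re (sesq K y y))))" for u x y
  proof -
    have e1: "exp (2 * \<psi> x (vec_cnj y) / of_real h) = exp (\<beta> x) * exp (sesq K x y) * exp (cnj (\<beta> y))"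
      by (simp add: pw(2) sesq_K \<beta>_def add_divide_distrib distrib_left flip: exp_add)
    have e2: "complex_of_real (exp (- 2 * \<Phi> y / h)) = exp (- \<beta> y) * exp (- cnj (\<beta> y)) * of_real (exp (- Re (sesq K y y)))"
      unfolding weight of_real_mult complex_norm_square by (simp add: exp_cnj)
    show ?thesis
      unfolding e1 e2 U_def by (simp add: exp_minus)
  qed
  have const: "det K / of_real (pi ^ CARD('n)) = 2 ^ CARD('n) * det (hessian_xy \<psi>) / of_real ((pi * h) ^ CARD('n))"
    using h by (simp add: det_K power_divide power_mult_distrib)
  have formula: "V (bergman_operator K (U u)) x = 2 ^ CARD('n) * det (hessian_xy \<psi>) / of_real ((pi * h) ^ CARD('n)) *
      (\<integral>y. exp (2 * \<psi> x (vec_cnj y) / of_real h) * u y * of_real (exp (- 2 * \<Phi> y / h)) \<partial>lebesgue)" for u x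
    unfolding kernel const[symmetric] V_def bergman_operator_def
    by (simp only: integral_mult_right_zero mult_ac)
  have "orthogonal_projection ?M ?H (\<lambda>u. V (bergman_operator K (U u)))"
    unfolding orthogonal_projection_def
  proof (intro ballI conjI)
    fix u assume u: "u \<in> L2_space ?M"
    then have Uu: "U u \<in> gaussian_L2 K" by (simp add: L2_iff)
    show P: "V (bergman_operator K (U u)) \<in> ?H"
      using bergman_operator_L2[OF K Uu] bergman_operator_holomorphic[OF K Uu] by (simp add: H_iff UV)
    fix v assume v: "v \<in> ?H"
    show "L2_inner ?M (\<lambda>x. u x - V (bergman_operator K (U u)) x) v = 0"
      unfolding inner[OF u P v] UV
      using v by (intro bergman_operator_orthogonal K Uu) (auto simp: H_iff)
  qed
  moreover have "integrable lebesgue (\<lambda>y. exp (2 * \<psi> x (vec_cnj y) / of_real h) * u y * of_real (exp (- 2 * \<Phi> y / h)))"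
    if "u \<in> L2_space ?M" for u x
    unfolding kernel using that by (intro integrable_mult_right kernel_integrable K) (simp add: L2_iff)
  moreover have "P u x = V (bergman_operator K (U u)) x"
    if P: "orthogonal_projection ?M ?H P" and u: "u \<in> L2_space ?M" for P u x
  proof -
    have Pu: "P u \<in> ?H" and orth: "\<And>v. v \<in> ?H \<Longrightarrow> L2_inner ?M (\<lambda>x. u x - P u x) v = 0"
      using P u by (auto simp: orthogonal_projection_def)
    have "U (P u) x = bergman_operator K (U u) x"
    proof (rule bergman_operator_unique[OF K])
      fix v assume "v \<in> gaussian_L2 K" "holomorphic_Cn v"
      then have "V v \<in> ?H" by (simp add: H_iff UV)
      from orth[OF this] show "(\<integral>y. (U u y - U (P u) y) * cnj (v y) * of_real (exp (- Re (sesq K y y))) \<partial>lebesgue) = 0"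
        unfolding inner[OF u Pu \<open>V v \<in> ?H\<close>] UV .
    qed (use u Pu in \<open>auto simp: L2_iff H_iff\<close>)
    then have "V (U (P u)) x = V (bergman_operator K (U u)) x"
      by (simp add: V_def)
    then show ?thesis by (simp add: UV)
  qed
  ultimately show ?thesis
    unfolding formula[symmetric] by blast
qed

end
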